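(* Let $1\leq p<\infty$, $0<\alpha\leq 1$ and $f\in A^p$. Then the following are equivalent: (a) $\|r_t(f)-f\|_{A^p}=O(|t|^{\alpha})$ as $t\to 0$; (b) $A_p(r,f')=O\left((1-r)^{\alpha-1}\right)$ as $r\to 1^{-}$; (c) $\|f_r-f\|_{A^p}=O\left((1-r)^{\alpha}\right)$ as $r\to 1^{-}$.
   Context: $\mathbb{D}$ is the open unit disc in $\mathbb{C}$ and $dm(z)=\frac{1}{\pi}\rho\,d\theta\,d\rho$ (with $z=\rho e^{i\theta}$) is the normalized Lebesgue area measure on $\mathbb{D}$. For $1\leq p<\infty$, the Bergman space $A^p$ consists of the analytic functions $f:\mathbb{D}\to\mathbb{C}$ with $\|f\|_{A^p}=\left(\int_{\mathbb{D}}|f(z)|^p\,dm(z)\right)^{1/p}<\infty$. For $f$ analytic on $\mathbb{D}$: the rotations are $r_t(f)(z)=f(e^{it}z)$, $t\in\mathbb{R}$; the dilations are $f_r(z)=f(rz)$, $0\leq r<1$; and $A_p(r,f)=\|f_r\|_{A^p}=\left(\int_{\mathbb{D}}|f(rz)|^p\,dm(z)\right)^{1/p}$ for $0\leq r<1$. In particular $A_p(r,f')=\left(\int_{\mathbb{D}}|f'(rz)|^p\,dm(z)\right)^{1/p}$. *)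

theory Defs
  imports
    "HOL-Complex_Analysis.Complex_Analysis"
    "HOL-Library.Landau_Symbols"
begin

abbreviation unit_disc :: "complex set" where
  "unit_disc \<equiv> ball 0 1"

text \<open>The measure written \<open>(1/\<pi>) \<rho> d\<theta> d\<rho>\<close> in polar coordinates.\<close>

definition area_measure :: "complex measure" where
  "area_measure = density (restrict_space lborel unit_disc) (\<lambda>_. ennreal (1 / pi))"

definition bergman_space :: "real \<Rightarrow> (complex \<Rightarrow> complex) set" where
  "bergman_space p = {f. f holomorphic_on unit_disc \<and>
     integrable area_measure (\<lambda>z. norm (f z) powr p)}"

text \<open>The Bochner integral is \<open>0\<close> where the integral diverges, so finiteness of the norm must be
  required separately, as the integrability condition in \<^const>\<open>bergman_space\<close> does.
  Rotations and differences of members of the space are again members, and proper dilations of any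
  function holomorphic on the disc are bounded on it, so for these the value below is the norm.\<close>

definition bergman_norm :: "real \<Rightarrow> (complex \<Rightarrow> complex) \<Rightarrow> real" where
  "bergman_norm p f = (\<integral>z. norm (f z) powr p \<partial>area_measure) powr (1 / p)"

definition rotation :: "real \<Rightarrow> (complex \<Rightarrow> complex) \<Rightarrow> complex \<Rightarrow> complex" where
  "rotation t f = (\<lambda>z. f (cis t * z))"

definition dilation :: "real \<Rightarrow> (complex \<Rightarrow> complex) \<Rightarrow> complex \<Rightarrow> complex" where
  "dilation r f = (\<lambda>z. f (of_real r * z))"

definition area_mean :: "real \<Rightarrow> real \<Rightarrow> (complex \<Rightarrow> complex) \<Rightarrow> real" where
  "area_mean p r f = bergman_norm p (dilation r f)"

end

theory Submission
  imports Defs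
begin

text \<open>
  Fix a point \<open>z\<close> of the disc. The slice \<open>w \<mapsto> f (w z)\<close> is holomorphic near the closed unit disc, so the
  Poisson formula writes \<open>f (r z)\<close> as the average of the rotations \<open>f (w z)\<close>, \<open>\<bar>w\<bar> = 1\<close>, against the
  Poisson density \<open>P\<^sub>r\<close>. Differentiating the slice at \<open>r\<close> gives in the same way
  \<open>z f' (r z)\<close> as the average of \<open>k (w) (f (w z) - c f (z))\<close> for every constant \<open>c\<close>, with
  \<open>\<bar>k (w)\<bar> \<le> 4 / \<bar>w - r\<bar>\<close>. Rotations preserve the Bergman norm, and by Jensen's inequality and Tonelli's
  theorem the norm of an average is at most the largest norm of the averaged functions
  (\<open>Lp_le_average\<close>). So estimates of norms reduce to estimates of numbers.

  From rotations to the derivative: take \<open>c = 1\<close>. The averaged functions have norm at most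
  a constant times \<open>\<bar>w - 1\<bar>\<^sup>\<alpha> / \<bar>w - r\<bar>\<close>, and \<open>\<bar>w - 1\<bar> \<le> 2 \<bar>w - r\<bar>\<close>, \<open>\<bar>w - r\<bar> \<ge> 1 - r\<close> turn this into
  a constant times \<open>(1 - r) powr (\<alpha> - 1)\<close>. The factor \<open>z\<close> is harmless, because \<open>f'\<close> is bounded on
  \<open>\<bar>z\<bar> \<le> 1/2\<close> (\<open>Lp_le_deriv_dilate\<close>, \<open>Lp_le_cancel_id\<close>).

  From the derivative to dilations: \<open>f (r z) - f (z)\<close> is an integral of \<open>f'\<close> along a radius, and
  \<open>(1 - s) powr (\<alpha> - 1)\<close> is integrable over \<open>r \<le> s < 1\<close>, with integral \<open>(1 - r) powr \<alpha> / \<alpha>\<close>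
  (\<open>Lp_le_dilation_diff\<close>). From the derivative to rotations: go from \<open>z\<close> to \<open>r z\<close> with
  \<open>1 - r = \<bar>t\<bar>\<close>, then along the circle through \<open>r z\<close>, then back out (\<open>Lp_le_rotation_diff\<close>).

  From dilations to the derivative (\<open>Lp_le_deriv_of_dilation_diff\<close>): let \<open>h\<close> be the mean of
  \<open>f (z) - f (s z)\<close> over \<open>r \<le> s \<le> 1\<close> for the measure \<open>ds / s\<close>. It is of order \<open>(1 - r) powr \<alpha>\<close>, hence
  \<open>z h' (r z)\<close> is of order \<open>(1 - r) powr (\<alpha> - 1)\<close> by the formula above with \<open>c = 0\<close>. On the other hand,
  \<open>z h' (z)\<close> differs from \<open>z f' (z)\<close> only by the difference quotient
  \<open>(f (z) - f (r z)) / ln (1 / r)\<close>, because the measure \<open>ds / s\<close> makes the derivative of the mean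
  telescope; and this quotient is of the same order by hypothesis. Nothing is summed over scales,
  so that there is no logarithmic loss at \<open>\<alpha> = 1\<close>.
\<close>

section \<open>Rotation invariance of area\<close>

lemma lborel_complex_eq_distr_pair:
  "(lborel :: complex measure) = distr (lborel \<Otimes>\<^sub>M lborel) borel (\<lambda>(x, y). Complex x y)"
proof (rule lborel_eqI)
  have m: "(\<lambda>(x, y). Complex x y) \<in> borel \<rightarrow>\<^sub>M borel"
    by (intro borel_measurable_continuous_onI) (auto simp: Complex_eq case_prod_beta intro!: continuous_intros)
  then have [measurable]: "(\<lambda>(x, y). Complex x y) \<in> lborel \<Otimes>\<^sub>M lborel \<rightarrow>\<^sub>M borel"
    by (simp add: lborel_prod)
  fix l u :: complex
  assume le: "\<And>b. b \<in> Basis \<Longrightarrow> l \<bullet> b \<le> u \<bullet> b"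
  then have le': "Re l \<le> Re u" "Im l \<le> Im u"
    using le[of 1] le[of "\<i>"] by (auto simp: Basis_complex_def)
  have "(\<lambda>(x, y). Complex x y) -` box l u \<inter> space (lborel \<Otimes>\<^sub>M lborel)
      = {Re l<..<Re u} \<times> {Im l<..<Im u}"
    by (auto simp: in_box_complex_iff space_pair_measure)
  then have "emeasure (distr (lborel \<Otimes>\<^sub>M lborel) borel (\<lambda>(x, y). Complex x y)) (box l u)
      = ennreal (Re u - Re l) * ennreal (Im u - Im l)"
    using le' by (simp add: emeasure_distr lborel.emeasure_pair_measure_Times)
  also have "\<dots> = (\<Prod>b\<in>Basis. (u - l) \<bullet> b)"
    using le' by (simp add: Basis_complex_def ennreal_mult)
  finally show "emeasure (distr (lborel \<Otimes>\<^sub>M lborel) borel (\<lambda>(x, y). Complex x y)) (box l u)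
      = (\<Prod>b\<in>Basis. (u - l) \<bullet> b)" .
qed simp

lemma borel_measurable_Complex [measurable (raw)]:
  assumes [measurable]: "f \<in> borel_measurable M" "g \<in> borel_measurable M"
  shows "(\<lambda>x. Complex (f x) (g x)) \<in> borel_measurable M"
  unfolding Complex_eq by measurable

lemma nn_integral_lborel_complex:
  assumes [measurable]: "g \<in> borel_measurable borel"
  shows "(\<integral>\<^sup>+z. g z \<partial>lborel) = (\<integral>\<^sup>+y. \<integral>\<^sup>+x. g (Complex x y) \<partial>lborel \<partial>lborel)"
  by (subst lborel_complex_eq_distr_pair)
     (simp add: nn_integral_distr lborel_pair.nn_integral_snd[symmetric] case_prod_beta)

text \<open>
  For a rotation with matrix rows \<open>(a, - b)\<close> and \<open>(b, a)\<close>, \<open>a \<noteq> 0\<close>, substitute first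
  \<open>u = a x - b y\<close> with \<open>y\<close> fixed; the second coordinate becomes \<open>(y + b u) / a\<close> because
  \<open>a\<^sup>2 + b\<^sup>2 = 1\<close>. Substituting that for \<open>y\<close> with \<open>u\<close> fixed cancels the factor \<open>1 / \<bar>a\<bar>\<close>. For \<open>a = 0\<close> the
  rotation only exchanges the axes, up to signs.
\<close>
lemma nn_integral_lborel_rotate:
  fixes g :: "complex \<Rightarrow> ennreal"
  assumes [measurable]: "g \<in> borel_measurable borel" and w: "norm w = 1"
  shows "(\<integral>\<^sup>+z. g (w * z) \<partial>lborel) = (\<integral>\<^sup>+z. g z \<partial>lborel)"
proof -
  define a b where "a = Re w" and "b = Im w"
  have ab: "a\<^sup>2 + b\<^sup>2 = 1"
    using w by (simp add: a_def b_def cmod_def)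
  have "(\<integral>\<^sup>+z. g (w * z) \<partial>lborel)
      = (\<integral>\<^sup>+y. \<integral>\<^sup>+x. g (Complex (a * x - b * y) (a * y + b * x)) \<partial>lborel \<partial>lborel)"
    by (subst nn_integral_lborel_complex)
       (auto simp: a_def b_def complex_eq_iff intro!: nn_integral_cong arg_cong[where f=g])
  also have "\<dots> = (\<integral>\<^sup>+z. g z \<partial>lborel)"
  proof (cases "a = 0")
    case False
    have "(\<integral>\<^sup>+y. \<integral>\<^sup>+x. g (Complex (a * x - b * y) (a * y + b * x)) \<partial>lborel \<partial>lborel)
        = (\<integral>\<^sup>+y. ennreal \<bar>1 / a\<bar> * (\<integral>\<^sup>+x. g (Complex x ((y + b * x) / a)) \<partial>lborel) \<partial>lborel)"
    proof (intro nn_integral_cong, goal_cases)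
      case (1 y)
      have "a * y + b * ((b * y) / a + (1 / a) * x) = (y * (a\<^sup>2 + b\<^sup>2) + b * x) / a" for x
        using False by (simp add: field_simps power2_eq_square)
      then have "a * y + b * ((b * y) / a + (1 / a) * x) = (y + b * x) / a" for x
        by (simp add: ab)
      then show ?case
        using False
        by (subst nn_integral_real_affine[where t="b * y / a" and c="1 / a"])
           (auto simp: algebra_simps)
    qed
    also have "\<dots> = ennreal \<bar>1 / a\<bar> * (\<integral>\<^sup>+y. \<integral>\<^sup>+x. g (Complex x ((y + b * x) / a)) \<partial>lborel \<partial>lborel)"
      by (rule nn_integral_cmult) measurable
    also have "(\<integral>\<^sup>+y. \<integral>\<^sup>+x. g (Complex x ((y + b * x) / a)) \<partial>lborel \<partial>lborel)
        = (\<integral>\<^sup>+x. \<integral>\<^sup>+y. g (Complex x ((y + b * x) / a)) \<partial>lborel \<partial>lborel)"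
      by (rule lborel_pair.Fubini') measurable
    also have "\<dots> = (\<integral>\<^sup>+x. ennreal \<bar>a\<bar> * (\<integral>\<^sup>+y. g (Complex x y) \<partial>lborel) \<partial>lborel)"
    proof (intro nn_integral_cong, goal_cases)
      case (1 x)
      show ?case
        using False by (subst nn_integral_real_affine[where t="- b * x" and c=a]) auto
    qed
    also have "\<dots> = ennreal \<bar>a\<bar> * (\<integral>\<^sup>+x. \<integral>\<^sup>+y. g (Complex x y) \<partial>lborel \<partial>lborel)"
      by (rule nn_integral_cmult) measurable
    also have "ennreal \<bar>1 / a\<bar> * \<dots> = (\<integral>\<^sup>+x. \<integral>\<^sup>+y. g (Complex x y) \<partial>lborel \<partial>lborel)"
      using False by (simp add: mult.assoc[symmetric] ennreal_mult[symmetric])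
    also have "\<dots> = (\<integral>\<^sup>+y. \<integral>\<^sup>+x. g (Complex x y) \<partial>lborel \<partial>lborel)"
      by (rule lborel_pair.Fubini'[symmetric]) measurable
    finally show ?thesis
      by (simp add: nn_integral_lborel_complex)
  next
    case True
    have b: "\<bar>b\<bar> = 1" "b \<noteq> 0"
      using ab True by (auto simp: power2_eq_1_iff)
    have "(\<integral>\<^sup>+y. \<integral>\<^sup>+x. g (Complex (a * x - b * y) (a * y + b * x)) \<partial>lborel \<partial>lborel)
        = (\<integral>\<^sup>+y. \<integral>\<^sup>+x. g (Complex (- b * y) x) \<partial>lborel \<partial>lborel)"
    proof (rule nn_integral_cong, goal_cases)
      case (1 y)
      show ?case
        using b True
        by (subst (2) nn_integral_real_affine[where t=0 and c=b]) auto
    qed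
    also have "\<dots> = (\<integral>\<^sup>+y. \<integral>\<^sup>+x. g (Complex y x) \<partial>lborel \<partial>lborel)"
      using b by (subst (2) nn_integral_real_affine[where t=0 and c="-b"]) auto
    also have "\<dots> = (\<integral>\<^sup>+y. \<integral>\<^sup>+x. g (Complex x y) \<partial>lborel \<partial>lborel)"
      by (rule lborel_pair.Fubini'[symmetric]) measurable
    finally show ?thesis
      by (simp add: nn_integral_lborel_complex)
  qed
  finally show ?thesis .
qed

lemma space_area_measure [simp]: "space area_measure = unit_disc"
  by (simp add: area_measure_def space_restrict_space)

lemma sets_area_measure [measurable_cong, simp]:
  "sets area_measure = sets (restrict_space borel unit_disc)"
  by (simp add: area_measure_def sets_restrict_space)

lemma nn_integral_area_measure:
  assumes [measurable]: "g \<in> borel_measurable borel"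
  shows "(\<integral>\<^sup>+z. g z \<partial>area_measure)
     = ennreal (1 / pi) * (\<integral>\<^sup>+z. g z * indicator unit_disc z \<partial>lborel)"
  unfolding area_measure_def
  by (subst nn_integral_density)
     (auto simp: nn_integral_restrict_space nn_integral_cmult mult.assoc measurable_restrict_space1)

lemma emeasure_area_measure_disc: "emeasure area_measure unit_disc = 1"
proof -
  have "emeasure area_measure unit_disc = (\<integral>\<^sup>+z. 1 \<partial>area_measure)"
    by simp
  also have "\<dots> = ennreal (1 / pi) * emeasure lborel unit_disc"
    by (subst nn_integral_area_measure) auto
  also have "\<dots> = 1"
    by (simp add: emeasure_ball unit_ball_vol_2 ennreal_mult[symmetric])
  finally show ?thesis .
qed

lemma nn_integral_area_measure_rotate:
  assumes [measurable]: "g \<in> borel_measurable borel" and w: "norm w = 1"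
  shows "(\<integral>\<^sup>+z. g (w * z) \<partial>area_measure) = (\<integral>\<^sup>+z. g z \<partial>area_measure)"
proof -
  have "indicator unit_disc (w * z) = (indicator unit_disc z :: ennreal)" for z
    using w by (simp add: indicator_def norm_mult)
  moreover have "(\<lambda>z. g z * indicator unit_disc z) \<in> borel_measurable borel"
    by (intro borel_measurable_times_ennreal borel_measurable_indicator) auto
  ultimately have "(\<integral>\<^sup>+z. g (w * z) * indicator unit_disc z \<partial>lborel)
      = (\<integral>\<^sup>+z. g z * indicator unit_disc z \<partial>lborel)"
    using nn_integral_lborel_rotate[OF _ w, of "\<lambda>z. g z * indicator unit_disc z"] by simp
  then show ?thesis
    by (simp add: nn_integral_area_measure)
qed

interpretation area: finite_measure area_measure
  by standard (simp add: emeasure_area_measure_disc)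

section \<open>Averages in the Bergman norm\<close>

lemma powr_above_tangent:
  fixes x h p :: real
  assumes p: "1 \<le> p" and x: "0 < x" and h: "0 \<le> h"
  shows "p * x powr (p - 1) * h \<le> h powr p + (p - 1) * x powr p"
proof (cases "h = 0")
  case False
  have "h powr p - x powr p \<ge> (p * x powr (p - 1)) * (h - x)"
  proof (rule convex_on_imp_above_tangent[where A="{0<..}"])
    show "((\<lambda>x. x powr p) has_real_derivative p * x powr (p - 1)) (at x within {0<..})"
      using x by (auto intro!: derivative_eq_intros simp: powr_diff)
  qed (use p x h False powr_convex in \<open>auto simp: interior_open\<close>)
  moreover have "x powr (p - 1) * x = x powr p"
    using x by (simp add: powr_diff)
  ultimately show ?thesis
    by (simp add: algebra_simps)
qed (use p in simp)

text \<open>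
  Jensen's inequality for \<open>h \<mapsto> h\<^sup>p\<close>, by integrating the tangent line at \<open>x\<close>. The point of tangency is
  the lower bound \<open>x\<close> and not the mean, so the mean may be infinite and the weight may have total
  mass below 1.
\<close>
lemma powr_le_nn_integral_weighted:
  fixes w h :: "'a \<Rightarrow> real"
  assumes p: "1 \<le> p" and [measurable]: "w \<in> borel_measurable M" "h \<in> borel_measurable M"
    and w0: "\<And>s. 0 \<le> w s" and h0: "\<And>s. 0 \<le> h s"
    and w1: "(\<integral>\<^sup>+s. ennreal (w s) \<partial>M) \<le> 1"
    and "0 \<le> x" and x: "ennreal x \<le> (\<integral>\<^sup>+s. ennreal (w s * h s) \<partial>M)"
  shows "ennreal (x powr p) \<le> (\<integral>\<^sup>+s. ennreal (w s * h s powr p) \<partial>M)"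
proof (cases "0 < x")
  case True
  define c where "c = (p - 1) * x powr p"
  have c0: "0 \<le> c" using p by (simp add: c_def)
  have "ennreal (p * x powr p) = ennreal (p * x powr (p - 1)) * ennreal x"
    using True p by (simp add: ennreal_mult[symmetric] powr_diff)
  also have "\<dots> \<le> ennreal (p * x powr (p - 1)) * (\<integral>\<^sup>+s. ennreal (w s * h s) \<partial>M)"
    by (intro mult_left_mono x) auto
  also have "\<dots> = (\<integral>\<^sup>+s. ennreal (w s * (p * x powr (p - 1) * h s)) \<partial>M)"
    using p w0 h0 by (subst nn_integral_cmult[symmetric]) (auto simp: ennreal_mult[symmetric] mult_ac)
  also have "\<dots> \<le> (\<integral>\<^sup>+s. ennreal (w s * h s powr p) + ennreal c * ennreal (w s) \<partial>M)"
  proof (intro nn_integral_mono, goal_cases)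
    case (1 s)
    have "w s * (p * x powr (p - 1) * h s) \<le> w s * (h s powr p + c)"
      using powr_above_tangent[OF p True h0] by (intro mult_left_mono w0) (simp add: c_def)
    then show ?case
      using w0[of s] c0
      by (simp add: ennreal_plus[symmetric] ennreal_mult[symmetric] algebra_simps
          del: ennreal_plus)
  qed
  also have "\<dots> = (\<integral>\<^sup>+s. ennreal (w s * h s powr p) \<partial>M) + ennreal c * (\<integral>\<^sup>+s. ennreal (w s) \<partial>M)"
    by (subst nn_integral_add) (auto simp: nn_integral_cmult)
  also have "\<dots> \<le> (\<integral>\<^sup>+s. ennreal (w s * h s powr p) \<partial>M) + ennreal c * 1"
    by (intro add_left_mono mult_left_mono w1) auto
  finally have "ennreal c + ennreal (x powr p) \<le> ennreal c + (\<integral>\<^sup>+s. ennreal (w s * h s powr p) \<partial>M)"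
    using c0 p by (simp add: ennreal_plus[symmetric] c_def algebra_simps del: ennreal_plus)
  then show ?thesis
    by (simp add: ennreal_add_left_cancel_le)
qed (use \<open>0 \<le> x\<close> in simp)

text \<open>
  Membership in the ball of radius \<open>K\<close> of \<open>L\<^sup>p\<close> for the area measure. As the integral is the
  extended nonnegative one, the predicate includes finiteness of the norm.
\<close>
definition Lp_le :: "real \<Rightarrow> (complex \<Rightarrow> complex) \<Rightarrow> real \<Rightarrow> bool" where
  "Lp_le p g K \<longleftrightarrow>
     0 \<le> K \<and> (\<integral>\<^sup>+z. ennreal (norm (g z) powr p) \<partial>area_measure) \<le> ennreal (K powr p)"

lemma Lp_le_nonneg: "Lp_le p g K \<Longrightarrow> 0 \<le> K"
  by (simp add: Lp_le_def)

lemma Lp_le_scale: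
  assumes p: "1 \<le> p" and h: "Lp_le p h K" "h \<in> borel_measurable area_measure" and c: "0 \<le> c"
    and le: "\<And>z. norm z < 1 \<Longrightarrow> norm (g z) \<le> c * norm (h z)" and K: "c * K \<le> K'"
  shows "Lp_le p g K'"
proof -
  note h(2) [measurable]
  have K0: "0 \<le> K" using h(1) by (rule Lp_le_nonneg)
  have "(\<integral>\<^sup>+z. ennreal (norm (g z) powr p) \<partial>area_measure)
      \<le> (\<integral>\<^sup>+z. ennreal (c powr p) * ennreal (norm (h z) powr p) \<partial>area_measure)"
  proof (intro nn_integral_mono, goal_cases)
    case (1 z)
    then have "norm (g z) powr p \<le> (c * norm (h z)) powr p"
      using le p by (intro powr_mono2) auto
    then show ?case
      using c by (simp add: powr_mult ennreal_mult[symmetric])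
  qed
  also have "\<dots> = ennreal (c powr p) * (\<integral>\<^sup>+z. ennreal (norm (h z) powr p) \<partial>area_measure)"
    by (rule nn_integral_cmult) measurable
  also have "\<dots> \<le> ennreal (c powr p) * ennreal (K powr p)"
    using h(1) by (intro mult_left_mono) (auto simp: Lp_le_def)
  also have "\<dots> = ennreal ((c * K) powr p)"
    using c K0 by (simp add: powr_mult ennreal_mult[symmetric])
  also have "\<dots> \<le> ennreal (K' powr p)"
    using K K0 c p by (intro ennreal_leI powr_mono2) auto
  finally show ?thesis
    using K K0 c by (auto simp: Lp_le_def intro: order_trans[of 0 "c * K"])
qed

lemma Lp_le_cong:
  assumes "Lp_le p h K" "\<And>z. norm z < 1 \<Longrightarrow> norm (g z) = norm (h z)"
  shows "Lp_le p g K"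
  using assms(1) assms(2) unfolding Lp_le_def
  by (auto cong: nn_integral_cong_simp)

lemma Lp_le_const:
  assumes "1 \<le> p" "0 \<le> K" "\<And>z. norm z < 1 \<Longrightarrow> norm (g z) \<le> K"
  shows "Lp_le p g K"
proof -
  have "(\<integral>\<^sup>+z. ennreal (norm (g z) powr p) \<partial>area_measure)
      \<le> (\<integral>\<^sup>+z. ennreal (K powr p) \<partial>area_measure)"
    using assms by (intro nn_integral_mono ennreal_leI powr_mono2) auto
  also have "\<dots> = ennreal (K powr p)"
    by (simp add: emeasure_area_measure_disc)
  finally show ?thesis
    using assms by (simp add: Lp_le_def)
qed

text \<open>
  Only orders of magnitude matter, so the triangle inequality up to the factor 2 suffices; it follows
  pointwise from \<open>(a + b)\<^sup>p \<le> 2\<^sup>p (a\<^sup>p + b\<^sup>p)\<close>.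
\<close>
lemma Lp_le_add:
  assumes p: "1 \<le> p"
    and h: "Lp_le p h K" "h \<in> borel_measurable area_measure"
    and k: "Lp_le p k L" "k \<in> borel_measurable area_measure"
    and le: "\<And>z. norm z < 1 \<Longrightarrow> norm (g z) \<le> norm (h z) + norm (k z)"
  shows "Lp_le p g (2 * (K + L))"
proof -
  note h(2) [measurable] k(2) [measurable]
  have K0: "0 \<le> K" "0 \<le> L" using h(1) k(1) by (auto intro: Lp_le_nonneg)
  have "(\<integral>\<^sup>+z. ennreal (norm (g z) powr p) \<partial>area_measure)
      \<le> (\<integral>\<^sup>+z. ennreal (2 powr p) * (ennreal (norm (h z) powr p) + ennreal (norm (k z) powr p)) \<partial>area_measure)"
  proof (intro nn_integral_mono, goal_cases)
    case (1 z)
    have "norm (g z) powr p \<le> (2 * max (norm (h z)) (norm (k z))) powr p"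
      using 1 p le[of z] by (intro powr_mono2) auto
    also have "\<dots> = 2 powr p * (max (norm (h z)) (norm (k z)) powr p)"
      by (simp add: powr_mult)
    also have "\<dots> \<le> 2 powr p * (norm (h z) powr p + norm (k z) powr p)"
      by (intro mult_left_mono) (auto simp: max_def)
    finally show ?case
      by (simp add: ennreal_plus[symmetric] ennreal_mult[symmetric] del: ennreal_plus)
  qed
  also have "\<dots> = ennreal (2 powr p) * ((\<integral>\<^sup>+z. ennreal (norm (h z) powr p) \<partial>area_measure)
        + (\<integral>\<^sup>+z. ennreal (norm (k z) powr p) \<partial>area_measure))"
    by (subst nn_integral_cmult) (auto simp: nn_integral_add)
  also have "\<dots> \<le> ennreal (2 powr p) * (ennreal (K powr p) + ennreal (L powr p))"
    using h(1) k(1) by (intro mult_left_mono add_mono) (auto simp: Lp_le_def)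
  also have "\<dots> = ennreal (2 powr p * (K powr p + L powr p))"
    by (simp add: ennreal_plus[symmetric] ennreal_mult[symmetric] del: ennreal_plus)
  also have "\<dots> \<le> ennreal (2 powr p * (K + L) powr p)"
  proof (intro ennreal_leI mult_left_mono)
    \<comment> \<open>superadditivity of powers with exponent at least 1\<close>
    show "K powr p + L powr p \<le> (K + L) powr p"
    proof (cases "K + L = 0")
      case False
      have "K powr p = K * K powr (p - 1)" "L powr p = L * L powr (p - 1)"
        "(K + L) powr p = (K + L) * (K + L) powr (p - 1)"
        using K0 by (auto simp: powr_diff)
      moreover have "K * K powr (p - 1) \<le> K * (K + L) powr (p - 1)"
        "L * L powr (p - 1) \<le> L * (K + L) powr (p - 1)"
        using K0 p by (auto intro!: mult_left_mono powr_mono2)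
      ultimately show ?thesis by (simp add: algebra_simps)
    next
      case True
      then have "K = 0" "L = 0" using K0 by auto
      then show ?thesis by simp
    qed
  qed simp
  also have "2 powr p * (K + L) powr p = (2 * (K + L)) powr p"
    using K0 by (subst powr_mult) auto
  finally show ?thesis
    using K0 by (simp add: Lp_le_def)
qed

text \<open>
  A form of Minkowski's integral inequality: raise the pointwise bound to the power \<open>p\<close> by Jensen's
  inequality, then exchange the two integrations.
\<close>
lemma Lp_le_average:
  assumes p: "1 \<le> p" and K: "0 \<le> K"
    and [measurable]: "w \<in> borel_measurable lborel"
    and H: "(\<lambda>(s, z). H s z) \<in> borel_measurable (lborel \<Otimes>\<^sub>M area_measure)"
    and w0: "\<And>s::real. 0 \<le> w s" and w1: "(\<integral>\<^sup>+s. ennreal (w s) \<partial>lborel) \<le> 1"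
    and bnd: "\<And>s. w s \<noteq> 0 \<Longrightarrow> Lp_le p (H s) K"
    and g: "\<And>z. norm z < 1 \<Longrightarrow>
       ennreal (norm (g z)) \<le> (\<integral>\<^sup>+s. ennreal (w s * norm (H s z)) \<partial>lborel)"
  shows "Lp_le p g K"
proof -
  interpret P: pair_sigma_finite lborel area_measure ..
  note H [measurable]
  have "(\<integral>\<^sup>+z. ennreal (norm (g z) powr p) \<partial>area_measure)
      \<le> (\<integral>\<^sup>+z. \<integral>\<^sup>+s. ennreal (w s * norm (H s z) powr p) \<partial>lborel \<partial>area_measure)"
  proof (intro nn_integral_mono, goal_cases)
    case (1 z)
    then have [measurable]: "(\<lambda>s. H s z) \<in> borel_measurable lborel"
      using measurable_compose[OF measurable_Pair2' H] by (simp add: comp_def)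
    show ?case
      using 1 by (intro powr_le_nn_integral_weighted p w0 w1 g) auto
  qed
  also have "\<dots> = (\<integral>\<^sup>+s. \<integral>\<^sup>+z. ennreal (w s * norm (H s z) powr p) \<partial>area_measure \<partial>lborel)"
    by (rule P.Fubini') measurable
  also have "\<dots> \<le> (\<integral>\<^sup>+s. ennreal (K powr p) * ennreal (w s) \<partial>lborel)"
  proof (intro nn_integral_mono, goal_cases)
    case (1 s)
    have [measurable]: "H s \<in> borel_measurable area_measure"
      using measurable_compose[OF measurable_Pair1' H] by simp
    have "(\<integral>\<^sup>+z. ennreal (w s * norm (H s z) powr p) \<partial>area_measure)
        = ennreal (w s) * (\<integral>\<^sup>+z. ennreal (norm (H s z) powr p) \<partial>area_measure)"
      using w0 by (subst nn_integral_cmult[symmetric]) (auto simp: ennreal_mult)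
    also have "\<dots> \<le> ennreal (w s) * ennreal (K powr p)"
      using bnd[of s] by (cases "w s = 0") (auto simp: Lp_le_def intro!: mult_left_mono)
    finally show ?case by (simp add: mult.commute)
  qed
  also have "\<dots> \<le> ennreal (K powr p) * 1"
    using w1 by (subst nn_integral_cmult) (auto intro!: mult_left_mono simp del: mult_1_right)
  finally show ?thesis
    using K by (simp add: Lp_le_def)
qed

lemma bergman_norm_le:
  assumes "1 \<le> p" "Lp_le p g K" "g \<in> borel_measurable area_measure"
  shows "bergman_norm p g \<le> K"
proof -
  note assms(3) [measurable]
  have "(\<integral>z. norm (g z) powr p \<partial>area_measure)
      = enn2real (\<integral>\<^sup>+z. ennreal (norm (g z) powr p) \<partial>area_measure)"
    by (rule integral_eq_nn_integral) auto
  also have "\<dots> \<le> enn2real (ennreal (K powr p))"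
    using assms by (intro enn2real_mono) (auto simp: Lp_le_def)
  finally have "(\<integral>z. norm (g z) powr p \<partial>area_measure) \<le> K powr p"
    by simp
  then have "bergman_norm p g \<le> (K powr p) powr (1 / p)"
    unfolding bergman_norm_def using assms by (intro powr_mono2) auto
  also have "\<dots> = K"
    using assms by (simp add: powr_powr Lp_le_def)
  finally show ?thesis .
qed

text \<open>
  The crude bound \<open>L\<close> excludes a divergent integral, for which \<^const>\<open>bergman_norm\<close> would be 0.
\<close>
lemma Lp_le_of_bergman_norm_le:
  assumes "1 \<le> p" "bergman_norm p g \<le> K" "Lp_le p g L" "g \<in> borel_measurable area_measure"
  shows "Lp_le p g K"
proof -
  note assms(4) [measurable]
  have fin: "(\<integral>\<^sup>+z. ennreal (norm (g z) powr p) \<partial>area_measure) < \<infinity>"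
    using assms by (auto simp: Lp_le_def intro: le_less_trans)
  then have int: "integrable area_measure (\<lambda>z. norm (g z) powr p)"
    by (intro integrableI_nonneg) auto
  have I: "(\<integral>z. norm (g z) powr p \<partial>area_measure) = bergman_norm p g powr p"
    using assms by (simp add: bergman_norm_def powr_powr)
  also have "\<dots> \<le> K powr p"
    using assms by (intro powr_mono2) (auto simp: bergman_norm_def)
  finally have "(\<integral>\<^sup>+z. ennreal (norm (g z) powr p) \<partial>area_measure) \<le> ennreal (K powr p)"
    using int by (subst nn_integral_eq_integral) (auto intro!: ennreal_leI)
  moreover have "0 \<le> K"
    using assms(2) by (simp add: bergman_norm_def) (metis order_trans powr_ge_zero)
  ultimately show ?thesis by (simp add: Lp_le_def)
qed

text \<open>
  Extension by zero: a function continuous on the disc only becomes Borel on the whole plane, so that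
  composing it with maps of a product space stays measurable.
\<close>
definition disc_part :: "(complex \<Rightarrow> complex) \<Rightarrow> complex \<Rightarrow> complex" where
  "disc_part f z = (if norm z < 1 then f z else 0)"

lemma disc_part_eq: "norm z < 1 \<Longrightarrow> disc_part f z = f z"
  by (simp add: disc_part_def)

lemma borel_measurable_disc_part:
  assumes "continuous_on unit_disc f"
  shows "disc_part f \<in> borel_measurable borel"
proof -
  have "disc_part f = (\<lambda>z. indicator unit_disc z *\<^sub>R f z)"
    by (auto simp: disc_part_def fun_eq_iff)
  then show ?thesis
    using borel_measurable_continuous_on_indicator[OF _ assms] by simp
qed

lemma continuous_imp_area_measurable:
  assumes "continuous_on unit_disc f"
  shows "f \<in> borel_measurable area_measure"
  using borel_measurable_continuous_on_restrict[OF assms]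
  by (simp cong: measurable_cong_sets)

lemma Lp_le_rotate:
  assumes f: "continuous_on unit_disc f" and w: "norm w = 1" and "Lp_le p f K"
  shows "Lp_le p (\<lambda>z. f (w * z)) K"
proof -
  note borel_measurable_disc_part[OF f, measurable]
  have "Lp_le p (disc_part f) K"
    using assms(3) by (rule Lp_le_cong) (simp add: disc_part_eq)
  then have "Lp_le p (\<lambda>z. disc_part f (w * z)) K"
    using nn_integral_area_measure_rotate[OF _ w, of "\<lambda>z. ennreal (norm (disc_part f z) powr p)"]
    by (simp add: Lp_le_def)
  then show ?thesis
    by (rule Lp_le_cong) (simp add: disc_part_eq w norm_mult)
qed

section \<open>Poisson averages\<close>

lemma ennreal_norm_integral_le:
  fixes f :: "real \<Rightarrow> complex"
  assumes f: "continuous_on {a..b} f" and I: "(f has_integral I) {a..b}"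
  shows "ennreal (norm I) \<le> (\<integral>\<^sup>+s. ennreal (indicator {a..b} s * norm (f s)) \<partial>lborel)"
proof -
  have int: "set_integrable lborel {a..b} f"
    by (rule borel_integrable_atLeastAtMost'[OF f])
  have "I = (LINT s:{a..b}|lborel. f s)"
    using set_borel_integral_eq_integral(2)[OF int] I by (simp add: integral_unique)
  then show ?thesis
    using integral_norm_bound_ennreal[OF int[unfolded set_integrable_def]]
    by (simp add: set_lebesgue_integral_def)
qed

lemma nn_integral_indicator_has_integral:
  fixes f :: "real \<Rightarrow> real"
  assumes [measurable]: "f \<in> borel_measurable borel" and "\<And>s. s \<in> {a..b} \<Longrightarrow> 0 \<le> f s"
    and I: "(f has_integral I) {a..b}"
  shows "(\<integral>\<^sup>+s. ennreal (indicator {a..b} s * f s) \<partial>lborel) = ennreal I"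
proof (rule nn_integral_has_integral_lborel)
  have "(\<lambda>s. indicator {a..b} s * f s) = (\<lambda>s. if s \<in> {a..b} then f s else 0)"
    by auto
  then show "((\<lambda>s. indicator {a..b} s * f s) has_integral I) UNIV"
    using I by (simp only: has_integral_restrict_UNIV)
qed (use assms in \<open>auto simp: indicator_def\<close>)

text \<open>The Poisson kernel of the disc at the real point \<open>r\<close>, normalized to have mean 1 on the circle.\<close>
definition poisson :: "real \<Rightarrow> complex \<Rightarrow> real" where
  "poisson r w = (1 - r\<^sup>2) / (norm (w - of_real r))\<^sup>2"

lemma poisson_nonneg: "\<bar>r\<bar> \<le> 1 \<Longrightarrow> 0 \<le> poisson r w"
  by (simp add: poisson_def abs_square_le_1)

lemma borel_measurable_poisson_cis [measurable]:
  "(\<lambda>s. poisson r (cis (2 * pi * s))) \<in> borel_measurable borel"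
  unfolding poisson_def cis_conv_exp by measurable

lemma norm_one_minus_mult_circle:
  fixes w :: complex
  assumes "norm w = 1"
  shows "norm (1 - of_real r * w) = norm (w - of_real r)"
proof -
  have "1 - of_real r * w = w * cnj (w - of_real r)"
    using complex_norm_square[of w] assms by (simp add: algebra_simps)
  then show ?thesis
    using assms by (simp add: norm_mult del: complex_cnj_diff)
qed

lemma norm_circle_minus_ge:
  fixes w :: complex
  assumes "norm w = 1" "0 \<le> r"
  shows "1 - r \<le> norm (w - of_real r)"
  using norm_triangle_ineq2[of w "complex_of_real r"] assms by (simp del: of_real_eq_id)

lemma norm_minus_one_le:
  fixes w :: complex
  assumes w: "norm w = 1" and r: "0 \<le> r" "r \<le> 1"
  shows "norm (w - 1) \<le> 2 * norm (w - of_real r)"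
proof -
  have "norm (w - 1) \<le> norm (w - of_real r) + norm (complex_of_real (r - 1))"
    using norm_triangle_ineq[of "w - of_real r" "complex_of_real (r - 1)"] by simp
  also have "norm (complex_of_real (r - 1)) = 1 - r"
    using r by (subst norm_of_real) simp
  finally show ?thesis
    using norm_circle_minus_ge[OF w r(1)] by simp
qed

lemma poisson_eq_kernel:
  assumes w: "norm w = 1" and r: "0 \<le> r" "r < 1"
  shows "of_real (poisson r w) = w * of_real (1 - r\<^sup>2) / ((1 - of_real r * w) * (w - of_real r))"
proof -
  have "1 - of_real r * w = w * cnj (w - of_real r)"
    using complex_norm_square[of w] w by (simp add: algebra_simps)
  then have "(1 - of_real r * w) * (w - of_real r) = w * ((w - of_real r) * cnj (w - of_real r))"
    by (simp add: algebra_simps)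
  also have "\<dots> = w * of_real ((norm (w - of_real r))\<^sup>2)"
    by (subst complex_norm_square) simp
  finally show ?thesis
    using w by (auto simp: poisson_def)
qed

lemma has_integral_unit_circle:
  assumes "(f has_contour_integral (2 * of_real pi * \<i> * I)) (circlepath 0 1)"
  shows "((\<lambda>s. f (cis (2 * pi * s)) * cis (2 * pi * s)) has_integral I) {0..1}"
proof -
  have e: "exp (2 * of_real pi * \<i> * of_real s) = cis (2 * pi * s)" for s
    by (simp add: cis_conv_exp mult_ac)
  have "((\<lambda>s. 1 / (2 * of_real pi * \<i>) * (f (cis (2 * pi * s)) * (2 * pi * \<i> * cis (2 * pi * s))))
      has_integral 1 / (2 * of_real pi * \<i>) * (2 * of_real pi * \<i> * I)) {0..1}"
    using assms unfolding has_contour_integral vector_derivative_circlepath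
    by (intro has_integral_mult_right) (simp add: circlepath e)
  then show ?thesis
    by (simp add: mult_ac)
qed

lemma one_minus_mult_disc_nz:
  assumes "norm w \<le> 1" "0 \<le> r" "r < 1"
  shows "1 - of_real r * w \<noteq> (0::complex)"
proof
  assume "1 - of_real r * w = 0"
  then have "norm (of_real r * w) = 1" by simp
  moreover have "norm (of_real r * w) \<le> r * 1"
    using assms by (simp add: norm_mult mult_left_le)
  ultimately show False using assms by simp
qed

text \<open>
  Cauchy's formula for \<open>h (w) (1 - r\<^sup>2) / (1 - r w)\<close>, which agrees with \<open>h\<close> at \<open>w = r\<close>: on the circle the
  extra factor turns the Cauchy kernel into the Poisson kernel.
\<close>
lemma poisson_formula:
  assumes h: "h holomorphic_on U" "cball 0 1 \<subseteq> U" and r: "0 \<le> r" "r < 1"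
  shows "((\<lambda>s. h (cis (2 * pi * s)) * of_real (poisson r (cis (2 * pi * s)))) has_integral h (of_real r)) {0..1}"
proof -
  define H where "H = (\<lambda>w. h w * of_real (1 - r\<^sup>2) / (1 - of_real r * w))"
  have "H holomorphic_on cball 0 1"
    unfolding H_def using h one_minus_mult_disc_nz[OF _ r]
    by (auto intro!: holomorphic_intros intro: holomorphic_on_subset)
  then have "((\<lambda>w. H w / (w - of_real r)) has_contour_integral 2 * of_real pi * \<i> * H (of_real r)) (circlepath 0 1)"
    using r by (intro Cauchy_integral_circlepath_simple) auto
  from has_integral_unit_circle[OF this]
  have "((\<lambda>s. h (cis (2 * pi * s)) * of_real (poisson r (cis (2 * pi * s)))) has_integral H (of_real r)) {0..1}"
    using r by (simp add: H_def poisson_eq_kernel mult_ac)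
  moreover have "H (of_real r) = h (of_real r)"
  proof -
    have "r\<^sup>2 < 1" using r by (simp add: abs_square_less_1)
    then have "complex_of_real (1 - r\<^sup>2) \<noteq> 0" unfolding of_real_eq_0_iff by simp
    moreover have "complex_of_real (1 - r\<^sup>2) = 1 - of_real r * of_real r" by (simp add: power2_eq_square)
    ultimately show ?thesis by (simp add: H_def)
  qed
  ultimately show ?thesis by simp
qed

text \<open>
  Cauchy's formula for the derivative, applied to the product of \<open>h\<close> and
  \<open>(1 - r\<^sup>2) (1 - w\<^sup>2) / (1 - r w)\<^sup>2\<close>. The numerator \<open>1 - w\<^sup>2\<close> vanishes at \<open>w = 1\<close>, so near this point
  the kernel is smaller than the Cauchy kernel \<open>(w - r)\<^sup>-\<^sup>2\<close>: it is the Poisson kernel times a factor of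
  order \<open>1 / \<bar>w - r\<bar>\<close>. The Cauchy kernel itself would lose a logarithm for Lipschitz functions.
\<close>
lemma poisson_formula_deriv:
  assumes h: "h holomorphic_on U" "open U" "cball 0 1 \<subseteq> U" and r: "0 \<le> r" "r < 1"
  defines "k \<equiv> \<lambda>w::complex. (1 - w\<^sup>2) / ((w - of_real r) * (1 - of_real r * w))"
  shows "((\<lambda>s. h (cis (2 * pi * s)) * of_real (poisson r (cis (2 * pi * s))) * k (cis (2 * pi * s)))
           has_integral deriv h (of_real r)) {0..1}"
proof -
  define G where "G = (\<lambda>w::complex. of_real (1 - r\<^sup>2) * (1 - w\<^sup>2) / (1 - of_real r * w)\<^sup>2)"
  have holH: "(\<lambda>w. h w * G w) holomorphic_on cball 0 1"
    unfolding G_def using h one_minus_mult_disc_nz[OF _ r]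
    by (auto intro!: holomorphic_intros intro: holomorphic_on_subset)
  have cont: "continuous_on (cball 0 1) (\<lambda>w. h w * G w)"
    using holH by (rule holomorphic_on_imp_continuous_on)
  have holb: "(\<lambda>w. h w * G w) holomorphic_on ball 0 1"
    using holH by (rule holomorphic_on_subset) auto
  have rb: "complex_of_real r \<in> ball 0 1" using r by simp
  note D = Cauchy_derivative_integral_circlepath[OF cont holb rb]
  have r2: "complex_of_real (1 - r\<^sup>2) \<noteq> 0"
    using r unfolding of_real_eq_0_iff by (simp add: power2_eq_1_iff)
  have r2': "1 - complex_of_real r * of_real r = of_real (1 - r\<^sup>2)"
    by (simp add: power2_eq_square)
  \<comment> \<open>The factor \<open>G\<close> equals 1 and is stationary at \<open>r\<close>, so it does not change the derivative.\<close>
  have G: "G (of_real r) = 1"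
    using r2 unfolding G_def r2' by (simp add: power2_eq_square)
  have G': "(G has_field_derivative 0) (at (of_real r))"
    unfolding G_def
    apply (rule derivative_eq_intros refl | use one_minus_mult_disc_nz[OF _ r, of "of_real r"] r in force)+
    using r2 unfolding r2' by (simp add: field_simps power2_eq_square)
  have "(h has_field_derivative deriv h (of_real r)) (at (of_real r))"
    using h rb by (intro holomorphic_derivI[of h U]) (auto simp: subset_iff)
  then have "((\<lambda>w. h w * G w) has_field_derivative deriv h (of_real r)) (at (of_real r))"
    using DERIV_mult[OF _ G', of h "deriv h (of_real r)"] G by simp
  with D(2) have "deriv h (of_real r)
      = 1 / (2 * of_real pi * \<i>) * contour_integral (circlepath 0 1) (\<lambda>u. h u * G u / (u - of_real r)\<^sup>2)"
    by (rule DERIV_unique[symmetric])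
  with D(1) have "((\<lambda>u. h u * G u / (u - of_real r)\<^sup>2) has_contour_integral
      2 * of_real pi * \<i> * deriv h (of_real r)) (circlepath 0 1)"
    by (simp add: has_contour_integral_integral)
  from has_integral_unit_circle[OF this] show ?thesis
    using r by (simp add: G_def k_def poisson_eq_kernel power2_eq_square mult_ac)
qed

lemma poisson_weight:
  assumes r: "0 \<le> r" "r < 1"
  shows "(\<integral>\<^sup>+s. ennreal (indicator {0..1} s * poisson r (cis (2 * pi * s))) \<partial>lborel) = 1"
proof -
  have "((\<lambda>s. complex_of_real (poisson r (cis (2 * pi * s)))) has_integral of_real 1) {0..1}"
    using poisson_formula[of "\<lambda>_. 1" UNIV r] r by simp
  then have "((\<lambda>s. poisson r (cis (2 * pi * s))) has_integral 1) {0..1}"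
    by (auto dest: has_integral_Re)
  then have "(\<integral>\<^sup>+s. ennreal (indicator {0..1} s * poisson r (cis (2 * pi * s))) \<partial>lborel) = ennreal 1"
    using r by (intro nn_integral_indicator_has_integral borel_measurable_poisson_cis poisson_nonneg) auto
  then show ?thesis by simp
qed

section \<open>Dilations and derivatives as averages of rotations\<close>

lemma Lp_le_poisson_average:
  assumes p: "1 \<le> p" and r: "0 \<le> r" "r < 1" and K: "0 \<le> K"
    and H: "(\<lambda>(s, z). H s z) \<in> borel_measurable (lborel \<Otimes>\<^sub>M area_measure)"
    and bnd: "\<And>s. Lp_le p (H s) K"
    and cont: "\<And>z. norm z < 1 \<Longrightarrow> continuous_on {0..1} (\<lambda>s. H s z)"
    and g: "\<And>z. norm z < 1 \<Longrightarrow>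
      ((\<lambda>s. of_real (poisson r (cis (2 * pi * s))) * H s z) has_integral g z) {0..1}"
  shows "Lp_le p g K"
proof (rule Lp_le_average[OF p K _ H])
  let ?w = "\<lambda>s. indicator {0..1} s * poisson r (cis (2 * pi * s))"
  show "?w \<in> borel_measurable lborel"
    by measurable
  show "0 \<le> ?w s" for s
    using r by (simp add: poisson_nonneg)
  show "(\<integral>\<^sup>+s. ennreal (?w s) \<partial>lborel) \<le> 1"
    using r by (simp add: poisson_weight)
  show "Lp_le p (H s) K" for s
    by (rule bnd)
  fix z :: complex
  assume z: "norm z < 1"
  have "cis (2 * pi * s) \<noteq> of_real r" for s
  proof
    assume "cis (2 * pi * s) = of_real r"
    then have "norm (cis (2 * pi * s)) = norm (complex_of_real r)" by simp
    then show False using r by simp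
  qed
  then have "continuous_on {0..1} (\<lambda>s. of_real (poisson r (cis (2 * pi * s))) * H s z)"
    unfolding poisson_def by (auto intro!: continuous_intros cont z)
  from ennreal_norm_integral_le[OF this g[OF z]]
  show "ennreal (norm (g z)) \<le> (\<integral>\<^sup>+s. ennreal (?w s * norm (H s z)) \<partial>lborel)"
    using r by (simp add: norm_mult poisson_nonneg mult.assoc)
qed

lemma measurable_area_borel [measurable (raw)]: "(\<lambda>z. z) \<in> area_measure \<rightarrow>\<^sub>M borel"
  by (simp add: area_measure_def measurable_restrict_space1)

lemma measurable_disc_part_mult:
  assumes f: "continuous_on unit_disc f" and c [measurable]: "c \<in> borel_measurable borel"
  shows "(\<lambda>(s::real, z). disc_part f (c s * z)) \<in> borel_measurable (lborel \<Otimes>\<^sub>M area_measure)"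
proof -
  note borel_measurable_disc_part[OF f, measurable]
  have [measurable]: "snd \<in> (lborel :: real measure) \<Otimes>\<^sub>M area_measure \<rightarrow>\<^sub>M borel"
    using measurable_compose[OF measurable_snd[of "lborel :: real measure" area_measure] measurable_area_borel]
    by (simp add: comp_def)
  show ?thesis
    by measurable
qed

lemma borel_measurable_cis [measurable]: "cis \<in> borel_measurable borel"
  by (intro borel_measurable_continuous_onI continuous_intros)

lemma norm_mult_less_one:
  fixes c z :: complex
  assumes "norm c \<le> 1" "norm z < 1"
  shows "norm (c * z) < 1"
proof -
  have "norm c * norm z \<le> norm z"
    using assms by (intro mult_left_le_one_le) auto
  then show ?thesis using assms by (simp add: norm_mult)
qed

lemma continuous_on_dilate:
  assumes "continuous_on unit_disc f" "norm c \<le> 1"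
  shows "continuous_on unit_disc (\<lambda>z. f (c * z))"
proof (rule continuous_on_compose2[OF assms(1)])
  show "(*) c ` unit_disc \<subseteq> unit_disc"
    using assms(2) by (auto intro: norm_mult_less_one)
qed (intro continuous_intros)

lemma slice_holomorphic:
  fixes z :: complex
  assumes "f holomorphic_on unit_disc" "norm z < 1"
  defines "U \<equiv> {w. norm (w * z) < 1}"
  shows "open U" "cball 0 1 \<subseteq> U" "(\<lambda>w. f (w * z)) holomorphic_on U"
proof -
  show "open U"
    unfolding U_def by (intro open_Collect_less continuous_intros)
  show "cball 0 1 \<subseteq> U"
    using assms(2) by (auto simp: U_def norm_mult intro: le_less_trans[OF mult_left_le_one_le])
  have "(f \<circ> (\<lambda>w. w * z)) holomorphic_on U"
    by (rule holomorphic_on_compose_gen[OF _ assms(1)]) (auto simp: U_def intro!: holomorphic_intros)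
  then show "(\<lambda>w. f (w * z)) holomorphic_on U" by (simp add: o_def)
qed

text \<open>A dilate is a Poisson average of rotations, and each rotation has the norm of \<open>f\<close>.\<close>
lemma Lp_le_dilate:
  assumes p: "1 \<le> p" and r: "0 \<le> r" "r < 1" and f: "f holomorphic_on unit_disc" and "Lp_le p f K"
  shows "Lp_le p (\<lambda>z. f (of_real r * z)) K"
proof (rule Lp_le_poisson_average[OF p r Lp_le_nonneg[OF assms(5)]])
  have cont: "continuous_on unit_disc f"
    by (rule holomorphic_on_imp_continuous_on[OF f])
  let ?H = "\<lambda>s z. disc_part f (cis (2 * pi * s) * z)"
  show "(\<lambda>(s, z). ?H s z) \<in> borel_measurable (lborel \<Otimes>\<^sub>M area_measure)"
    by (rule measurable_disc_part_mult[OF cont]) measurable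
  show "Lp_le p (?H s) K" for s
    by (rule Lp_le_cong[OF Lp_le_rotate[OF cont _ assms(5), of "cis (2 * pi * s)"]])
       (auto simp: disc_part_def norm_mult)
  fix z :: complex
  assume z: "norm z < 1"
  have eq: "?H s z = f (cis (2 * pi * s) * z)" for s
    using z by (simp add: disc_part_def norm_mult)
  show "continuous_on {0..1} (\<lambda>s. ?H s z)"
    unfolding eq using z
    by (intro continuous_on_compose2[OF cont] continuous_intros) (auto simp: norm_mult)
  note S = slice_holomorphic[OF f z]
  show "((\<lambda>s. of_real (poisson r (cis (2 * pi * s))) * ?H s z) has_integral f (of_real r * z)) {0..1}"
    unfolding eq using poisson_formula[OF S(3,2) r] by (simp add: mult.commute)
qed

text \<open>
  The constant \<open>c\<close> is free because a constant added to the slice \<open>w \<mapsto> f (w z)\<close> does not change its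
  derivative; \<open>c = 0\<close> gives a Cauchy estimate and \<open>c = 1\<close> exploits smoothness under rotations. On the
  circle \<open>\<bar>1 - w\<^sup>2\<bar> \<le> 2 \<bar>1 - w\<bar> \<le> 4 \<bar>w - r\<bar>\<close>, which leaves the factor \<open>4 / \<bar>w - r\<bar>\<close>.
\<close>
lemma Lp_le_deriv_dilate:
  fixes c :: complex
  assumes p: "1 \<le> p" and r: "0 \<le> r" "r < 1" and f: "f holomorphic_on unit_disc" and K: "0 \<le> K"
    and B: "\<And>w. norm w = 1 \<Longrightarrow> Lp_le p (\<lambda>z. f (w * z) - c * f z) (B w)"
    and BK: "\<And>w. norm w = 1 \<Longrightarrow> 4 / norm (w - of_real r) * B w \<le> K"
  shows "Lp_le p (\<lambda>z. z * deriv f (of_real r * z)) K"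
proof (rule Lp_le_poisson_average[OF p r K])
  have cont: "continuous_on unit_disc f"
    by (rule holomorphic_on_imp_continuous_on[OF f])
  define k where "k = (\<lambda>w::complex. (1 - w\<^sup>2) / ((w - of_real r) * (1 - of_real r * w)))"
  have knorm: "norm (k w) \<le> 4 / norm (w - of_real r)" if w: "norm w = 1" for w
  proof -
    let ?d = "norm (w - of_real r)"
    have d: "1 - r \<le> ?d" "0 < ?d"
      using norm_circle_minus_ge[OF w r(1)] r by auto
    have "1 - w\<^sup>2 = (1 - w) * (1 + w)"
      by (simp add: power2_eq_square algebra_simps)
    then have "norm (1 - w\<^sup>2) = norm (1 - w) * norm (1 + w)"
      by (simp add: norm_mult)
    also have "\<dots> \<le> (2 * ?d) * 2"
    proof (intro mult_mono)
      show "norm (1 - w) \<le> 2 * ?d"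
        using norm_minus_one_le[OF w, of r] r by (simp add: norm_minus_commute)
      show "norm (1 + w) \<le> 2"
        using norm_triangle_ineq[of 1 w] w by simp
    qed auto
    finally have "norm (1 - w\<^sup>2) / ?d\<^sup>2 \<le> 4 * ?d / ?d\<^sup>2"
      by (intro divide_right_mono) auto
    then show ?thesis
      using d by (simp add: k_def norm_divide norm_mult norm_one_minus_mult_circle[OF w] power2_eq_square)
  qed
  let ?H = "\<lambda>s z. k (cis (2 * pi * s)) * (disc_part f (cis (2 * pi * s) * z) - c * disc_part f (1 * z))"
  have [measurable]: "k \<in> borel_measurable borel"
    unfolding k_def by measurable
  have mD: "(\<lambda>(s::real, z). disc_part f (cis (2 * pi * s) * z)) \<in> borel_measurable (lborel \<Otimes>\<^sub>M area_measure)"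
    by (rule measurable_disc_part_mult[OF cont]) measurable
  have mD1: "(\<lambda>(s::real, z). disc_part f (1 * z)) \<in> borel_measurable (lborel \<Otimes>\<^sub>M area_measure)"
    by (rule measurable_disc_part_mult[OF cont]) measurable
  note mD [measurable] mD1 [measurable]
  show "(\<lambda>(s, z). ?H s z) \<in> borel_measurable (lborel \<Otimes>\<^sub>M area_measure)"
    by measurable
  have eq: "?H s z = k (cis (2 * pi * s)) * (f (cis (2 * pi * s) * z) - c * f z)" if "norm z < 1" for s z
    using that by (simp add: disc_part_def norm_mult)
  show "Lp_le p (?H s) K" for s
  proof (rule Lp_le_scale[OF p B[of "cis (2 * pi * s)"]])
    let ?w = "cis (2 * pi * s)"
    show "norm (?H s z) \<le> 4 / norm (?w - of_real r) * norm (f (?w * z) - c * f z)" if "norm z < 1" for z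
      unfolding eq[OF that] norm_mult using knorm[of ?w] by (intro mult_right_mono) auto
    show "4 / norm (?w - of_real r) * B ?w \<le> K"
      by (rule BK) simp
    show "(\<lambda>z. f (?w * z) - c * f z) \<in> borel_measurable area_measure"
      by (intro continuous_imp_area_measurable continuous_intros continuous_on_dilate cont) simp
  qed auto
  fix z :: complex
  assume z: "norm z < 1"
  show "continuous_on {0..1} (\<lambda>s. ?H s z)"
  proof -
    have "w \<noteq> of_real r \<and> 1 - of_real r * w \<noteq> 0" if "norm w = 1" for w :: complex
      using one_minus_mult_disc_nz[of w r] that r by auto
    then have k: "continuous_on (sphere 0 1) k"
      unfolding k_def by (intro continuous_intros) auto
    show ?thesis
      unfolding eq[OF z] using z
      by (intro continuous_on_compose2[OF cont] continuous_on_compose2[OF k] continuous_intros)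
         (auto simp: norm_mult)
  qed
  note S = slice_holomorphic[OF f z]
  have rz: "of_real r * z \<in> unit_disc"
    using z r by (auto intro: norm_mult_less_one)
  have "(f has_field_derivative deriv f (of_real r * z)) (at (of_real r * z))"
    by (rule holomorphic_derivI[OF f _ rz]) auto
  then have "((\<lambda>w. f (w * z) - c * f z) has_field_derivative (deriv f (of_real r * z) * z)) (at (of_real r))"
    by (auto intro!: derivative_eq_intros DERIV_chain2[where f=f])
  then have D: "deriv (\<lambda>w. f (w * z) - c * f z) (of_real r) = z * deriv f (of_real r * z)"
    by (simp add: DERIV_imp_deriv mult.commute)
  have "(\<lambda>w. f (w * z) - c * f z) holomorphic_on {w. norm (w * z) < 1}"
    using S(3) by (intro holomorphic_intros) auto
  then have "((\<lambda>s. (f (cis (2 * pi * s) * z) - c * f z) * of_real (poisson r (cis (2 * pi * s))) * k (cis (2 * pi * s)))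
      has_integral deriv (\<lambda>w. f (w * z) - c * f z) (of_real r)) {0..1}"
    unfolding k_def by (rule poisson_formula_deriv[OF _ S(1,2) r])
  then show "((\<lambda>s. of_real (poisson r (cis (2 * pi * s))) * ?H s z) has_integral z * deriv f (of_real r * z)) {0..1}"
    unfolding eq[OF z] D by (simp add: mult_ac)
qed

text \<open>
  For \<open>\<bar>z\<bar> \<ge> 1/2\<close> the factor \<open>z\<close> costs at most 2, and for \<open>\<bar>z\<bar> \<le> 1/2\<close> the bound \<open>M\<close> applies.
\<close>
lemma Lp_le_cancel_id:
  assumes p: "1 \<le> p" and r: "0 \<le> r" "r \<le> 1" and g: "continuous_on unit_disc g"
    and K: "Lp_le p (\<lambda>z. z * g (of_real r * z)) K"
    and M: "\<And>z. norm z \<le> 1 / 2 \<Longrightarrow> norm (g z) \<le> M"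
  shows "Lp_le p (\<lambda>z. g (of_real r * z)) (2 * (2 * K + M))"
proof (rule Lp_le_add[OF p])
  have M0: "0 \<le> M" using M[of 0] by (simp add: order_trans[OF norm_ge_zero])
  have cont: "continuous_on unit_disc (\<lambda>z. g (of_real r * z))"
    using r by (intro continuous_on_dilate[OF g]) simp
  have meas: "(\<lambda>z. z * g (of_real r * z)) \<in> borel_measurable area_measure"
    by (intro continuous_imp_area_measurable continuous_intros cont)
  show "Lp_le p (\<lambda>z. 2 * (z * g (of_real r * z))) (2 * K)"
    by (rule Lp_le_scale[OF p K meas, of 2]) (auto simp: norm_mult)
  show "(\<lambda>z. 2 * (z * g (of_real r * z))) \<in> borel_measurable area_measure"
    by (intro continuous_imp_area_measurable continuous_intros cont)
  show "Lp_le p (\<lambda>z. of_real M) M"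
    using M0 by (intro Lp_le_const p) auto
  fix z :: complex
  assume "norm z < 1"
  show "norm (g (of_real r * z)) \<le> norm (2 * (z * g (of_real r * z))) + norm (complex_of_real M)"
  proof (cases "norm z \<le> 1 / 2")
    case True
    have "norm (of_real r * z) \<le> norm z"
      using r by (simp add: norm_mult mult_left_le_one_le)
    then have "norm (g (of_real r * z)) \<le> M"
      using True by (intro M) simp
    then show ?thesis using M0 by (simp add: add_increasing)
  next
    case False
    then have "1 * norm (g (of_real r * z)) \<le> (2 * norm z) * norm (g (of_real r * z))"
      by (intro mult_right_mono) auto
    then show ?thesis by (simp add: norm_mult add_increasing2)
  qed
qed simp

section \<open>Increments along radii and circles\<close>

lemma ennreal_norm_increment_le:
  fixes F :: "real \<Rightarrow> complex"
  assumes "a \<le> b"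
    and "\<And>u. u \<in> {a..b} \<Longrightarrow> (F has_vector_derivative F' u) (at u within {a..b})"
    and "continuous_on {a..b} F'"
  shows "ennreal (norm (F b - F a)) \<le> (\<integral>\<^sup>+u. ennreal (indicator {a..b} u * norm (F' u)) \<partial>lborel)"
  using assms by (intro ennreal_norm_integral_le fundamental_theorem_of_calculus)

lemma has_vector_derivative_along:
  assumes f: "f holomorphic_on unit_disc" and "norm (c u) < 1"
    and c: "(c has_vector_derivative c') (at u within S)"
  shows "((\<lambda>u. f (c u)) has_vector_derivative c' * deriv f (c u)) (at u within S)"
proof -
  have "(f has_field_derivative deriv f (c u)) (at (c u))"
    by (rule holomorphic_derivI[OF f]) (use assms in auto)
  then have "(f \<circ> c has_vector_derivative c' * deriv f (c u)) (at u within S)"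
    by (intro field_vector_diff_chain_within c) (rule has_field_derivative_at_within)
  then show ?thesis by (simp add: o_def)
qed

lemma has_vector_derivative_cis_mult:
  "((\<lambda>u. cis (t * u)) has_vector_derivative \<i> * of_real t * cis (t * u)) (at u within S)"
proof -
  have "((\<lambda>w. exp (\<i> * of_real t * w)) has_field_derivative \<i> * of_real t * exp (\<i> * of_real t * of_real u))
      (at (of_real u))"
    by (auto intro!: derivative_eq_intros)
  from has_vector_derivative_real_field[OF this, of S] show ?thesis
    by (simp add: cis_conv_exp mult_ac)
qed

lemma continuous_on_deriv_disc:
  assumes "f holomorphic_on unit_disc"
  shows "continuous_on unit_disc (deriv f)"
  by (intro holomorphic_on_imp_continuous_on holomorphic_deriv assms) auto

text \<open>
  With \<open>u = 1 - s\<close>, the increment of \<open>f\<close> along a radius is an integral of \<open>f'\<close> over \<open>0 \<le> u \<le> 1 - r\<close>.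
  Averaging against the probability density proportional to \<open>u powr (\<alpha> - 1)\<close> gives all averaged
  functions the same bound, so nothing is lost by taking the largest.
\<close>
lemma Lp_le_dilation_diff:
  assumes p: "1 \<le> p" and \<alpha>: "0 < \<alpha>" and f: "f holomorphic_on unit_disc"
    and r: "0 \<le> r" "r < 1" and C: "0 \<le> C"
    and bnd: "\<And>s. r \<le> s \<Longrightarrow> s < 1 \<Longrightarrow>
       Lp_le p (\<lambda>z. deriv f (of_real s * z)) (C * (1 - s) powr (\<alpha> - 1))"
  shows "Lp_le p (\<lambda>z. f (of_real r * z) - f z) (C / \<alpha> * (1 - r) powr \<alpha>)"
proof -
  define \<delta> where "\<delta> = 1 - r"
  have \<delta>: "0 < \<delta>" "\<delta> \<le> 1" "r = 1 - \<delta>" using r by (auto simp: \<delta>_def)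
  note contd = continuous_on_deriv_disc[OF f]
  let ?w = "\<lambda>u. indicator {0..\<delta>} u * (\<alpha> / \<delta> powr \<alpha> * u powr (\<alpha> - 1))"
  let ?H = "\<lambda>u z. of_real (\<delta> powr \<alpha> / \<alpha> * u powr (1 - \<alpha>)) * disc_part (deriv f) (of_real (1 - u) * z)"
  show ?thesis
  proof (rule Lp_le_average[where w = ?w and H = ?H, OF p])
    show "0 \<le> C / \<alpha> * (1 - r) powr \<alpha>" using C \<alpha> by simp
    show "?w \<in> borel_measurable lborel" by measurable
    have "(\<lambda>(u::real, z). disc_part (deriv f) (of_real (1 - u) * z))
        \<in> borel_measurable (lborel \<Otimes>\<^sub>M area_measure)"
      by (rule measurable_disc_part_mult[OF contd]) measurable
    note this [measurable]
    show "(\<lambda>(u, z). ?H u z) \<in> borel_measurable (lborel \<Otimes>\<^sub>M area_measure)"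
      by measurable
    show "0 \<le> ?w s" for s using \<alpha> \<delta> by simp
    have "((\<lambda>u. \<alpha> / \<delta> powr \<alpha> * u powr (\<alpha> - 1)) has_integral
        \<alpha> / \<delta> powr \<alpha> * (\<delta> powr (\<alpha> - 1 + 1) / (\<alpha> - 1 + 1))) {0..\<delta>}"
      using \<alpha> \<delta> by (intro has_integral_mult_right has_integral_powr_from_0) auto
    then have "((\<lambda>u. \<alpha> / \<delta> powr \<alpha> * u powr (\<alpha> - 1)) has_integral 1) {0..\<delta>}"
      using \<alpha> \<delta> by simp
    then have "(\<integral>\<^sup>+u. ennreal (?w u) \<partial>lborel) = ennreal 1"
      using \<alpha> by (intro nn_integral_indicator_has_integral) auto
    then show "(\<integral>\<^sup>+u. ennreal (?w u) \<partial>lborel) \<le> 1" by simp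
  next
    fix u assume "?w u \<noteq> 0"
    then have u: "0 < u" "u \<le> \<delta>" by (auto simp: indicator_def split: if_splits)
    have "Lp_le p (\<lambda>z. deriv f (of_real (1 - u) * z)) (C * u powr (\<alpha> - 1))"
      using bnd[of "1 - u"] u \<delta> by auto
    moreover have "(\<lambda>z. deriv f (of_real (1 - u) * z)) \<in> borel_measurable area_measure"
      using u \<delta> by (intro continuous_imp_area_measurable continuous_on_dilate contd)
        (simp del: of_real_diff)
    ultimately show "Lp_le p (?H u) (C / \<alpha> * (1 - r) powr \<alpha>)"
    proof (rule Lp_le_scale[OF p, where c="\<delta> powr \<alpha> / \<alpha> * u powr (1 - \<alpha>)"])
      show "0 \<le> \<delta> powr \<alpha> / \<alpha> * u powr (1 - \<alpha>)" using \<alpha> by simp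
      have "u powr (1 - \<alpha>) * u powr (\<alpha> - 1) = 1"
        using u by (simp flip: powr_add)
      then show "\<delta> powr \<alpha> / \<alpha> * u powr (1 - \<alpha>) * (C * u powr (\<alpha> - 1)) \<le> C / \<alpha> * (1 - r) powr \<alpha>"
        using \<delta> by (simp add: mult_ac)
      fix z :: complex assume "norm z < 1"
      then have "norm (of_real (1 - u) * z) < 1"
        using u \<delta> by (intro norm_mult_less_one) (simp_all del: of_real_diff)
      then show "norm (?H u z) \<le> \<delta> powr \<alpha> / \<alpha> * u powr (1 - \<alpha>) * norm (deriv f (of_real (1 - u) * z))"
        using \<alpha> by (simp add: disc_part_eq norm_mult norm_divide del: of_real_diff)
    qed
  next
    fix z :: complex assume z: "norm z < 1"
    have in_disc: "norm (of_real (1 - u) * z) < 1" if "u \<in> {0..\<delta>}" for u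
      using that \<delta> z by (intro norm_mult_less_one) (simp_all del: of_real_diff)
    have "ennreal (norm (f (of_real (1 - \<delta>) * z) - f (of_real (1 - 0) * z)))
        \<le> (\<integral>\<^sup>+u. ennreal (indicator {0..\<delta>} u * norm ((- z) * deriv f (of_real (1 - u) * z))) \<partial>lborel)"
    proof (rule ennreal_norm_increment_le)
      fix u assume u: "u \<in> {0..\<delta>}"
      show "((\<lambda>u. f (of_real (1 - u) * z)) has_vector_derivative - z * deriv f (of_real (1 - u) * z))
          (at u within {0..\<delta>})"
        by (rule has_vector_derivative_along[where c="\<lambda>u. of_real (1 - u) * z", OF f in_disc[OF u]])
           (auto intro!: derivative_eq_intros simp: algebra_simps)
    next
      show "continuous_on {0..\<delta>} (\<lambda>u. - z * deriv f (of_real (1 - u) * z))"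
        using in_disc
        by (intro continuous_intros continuous_on_compose2[OF contd]) auto
    qed (use \<delta> in auto)
    \<comment> \<open>At \<open>u = 0\<close> the powers take the value 0, and the two integrands differ there.\<close>
    also have "\<dots> \<le> (\<integral>\<^sup>+u. ennreal (?w u * norm (?H u z)) \<partial>lborel)"
    proof (rule nn_integral_mono_AE, rule AE_mp[OF AE_lborel_singleton[of 0]], intro AE_I2 impI)
      fix u :: real assume "u \<noteq> 0"
      show "ennreal (indicator {0..\<delta>} u * norm (- z * deriv f (of_real (1 - u) * z))) \<le> ennreal (?w u * norm (?H u z))"
      proof (cases "u \<in> {0..\<delta>}")
        case True
        have "u powr (1 - \<alpha>) * u powr (\<alpha> - 1) = 1"
          using True \<open>u \<noteq> 0\<close> by (simp flip: powr_add)
        moreover have "norm (?H u z) = \<delta> powr \<alpha> / \<alpha> * u powr (1 - \<alpha>) * norm (deriv f (of_real (1 - u) * z))"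
          using \<alpha> in_disc[OF True] by (simp add: norm_mult norm_divide disc_part_eq del: of_real_diff)
        ultimately have "?w u * norm (?H u z) = norm (deriv f (of_real (1 - u) * z))"
          using True \<alpha> \<delta> by (simp add: mult_ac)
        then show ?thesis
          using True z by (auto simp: norm_mult intro!: ennreal_leI mult_left_le_one_le)
      qed simp
    qed
    finally show "ennreal (norm (f (of_real r * z) - f z)) \<le> (\<integral>\<^sup>+u. ennreal (?w u * norm (?H u z)) \<partial>lborel)"
      using \<delta> by simp
  qed
qed

text \<open>
  Integrate \<open>f'\<close> along the arc from \<open>r z\<close> to \<open>r e\<^sup>i\<^sup>t z\<close>, parametrized over \<open>0 \<le> u \<le> 1\<close> in order to
  treat both signs of \<open>t\<close> at once.
\<close>
lemma Lp_le_rotation_diff_dilated: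
  assumes p: "1 \<le> p" and f: "f holomorphic_on unit_disc" and r: "0 \<le> r" "r \<le> 1"
    and K: "Lp_le p (\<lambda>z. deriv f (of_real r * z)) K"
  shows "Lp_le p (\<lambda>z. f (of_real r * (cis t * z)) - f (of_real r * z)) (\<bar>t\<bar> * K)"
proof -
  note contd = continuous_on_deriv_disc[OF f]
  let ?w = "\<lambda>u::real. indicator {0..1} u * 1 :: real"
  let ?H = "\<lambda>u z. of_real t * disc_part (deriv f) (of_real r * cis (t * u) * z)"
  have in_disc: "norm (of_real r * cis (t * u) * z) < 1" if "norm z < 1" for u z
    using that r by (intro norm_mult_less_one) (auto simp: norm_mult)
  show ?thesis
  proof (rule Lp_le_average[where w = ?w and H = ?H, OF p])
    show "0 \<le> \<bar>t\<bar> * K" using Lp_le_nonneg[OF K] by simp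
    have "(\<lambda>(u::real, z). disc_part (deriv f) (of_real r * cis (t * u) * z))
        \<in> borel_measurable (lborel \<Otimes>\<^sub>M area_measure)"
      by (rule measurable_disc_part_mult[OF contd]) measurable
    note this [measurable]
    show "(\<lambda>(u, z). ?H u z) \<in> borel_measurable (lborel \<Otimes>\<^sub>M area_measure)"
      by measurable
    have "(\<integral>\<^sup>+u. ennreal (?w u) \<partial>lborel) = ennreal 1"
      by (simp add: ennreal_indicator)
    then show "(\<integral>\<^sup>+u. ennreal (?w u) \<partial>lborel) \<le> 1" by simp
  next
    fix u
    have "continuous_on unit_disc (\<lambda>z. deriv f (of_real r * z))"
      using r by (intro continuous_on_dilate contd) simp
    from Lp_le_rotate[OF this _ K, of "cis (t * u)"]
    have "Lp_le p (\<lambda>z. deriv f (of_real r * (cis (t * u) * z))) K" by simp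
    moreover have "(\<lambda>z. deriv f (of_real r * (cis (t * u) * z))) \<in> borel_measurable area_measure"
      using r unfolding mult.assoc[symmetric]
      by (intro continuous_imp_area_measurable continuous_on_dilate contd) (simp add: norm_mult)
    ultimately show "Lp_le p (?H u) (\<bar>t\<bar> * K)"
      by (rule Lp_le_scale[OF p, where c="\<bar>t\<bar>"])
         (use in_disc in \<open>auto simp: norm_mult disc_part_eq mult.assoc\<close>)
  next
    fix z :: complex assume z: "norm z < 1"
    have "ennreal (norm (f (of_real r * cis (t * 1) * z) - f (of_real r * cis (t * 0) * z)))
        \<le> (\<integral>\<^sup>+u. ennreal (indicator {0..1} u *
            norm ((of_real r * (\<i> * of_real t * cis (t * u)) * z) * deriv f (of_real r * cis (t * u) * z))) \<partial>lborel)"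
    proof (rule ennreal_norm_increment_le)
      fix u :: real
      show "((\<lambda>u. f (of_real r * cis (t * u) * z)) has_vector_derivative
          (of_real r * (\<i> * of_real t * cis (t * u)) * z) * deriv f (of_real r * cis (t * u) * z)) (at u within {0..1})"
        by (rule has_vector_derivative_along[where c="\<lambda>u. of_real r * cis (t * u) * z", OF f in_disc[OF z]])
           (intro has_vector_derivative_mult_left has_vector_derivative_mult_right has_vector_derivative_cis_mult)
    next
      show "continuous_on {0..1} (\<lambda>u. (of_real r * (\<i> * of_real t * cis (t * u)) * z) * deriv f (of_real r * cis (t * u) * z))"
        using in_disc[OF z]
        by (intro continuous_intros continuous_on_compose2[OF contd]) auto
    qed simp
    also have "\<dots> \<le> (\<integral>\<^sup>+u. ennreal (?w u * norm (?H u z)) \<partial>lborel)"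
    proof (rule nn_integral_mono, goal_cases)
      case (1 u)
      have "r * norm z \<le> 1" using r z by (intro mult_le_one) auto
      then have "(r * norm z) * (\<bar>t\<bar> * norm (deriv f (of_real r * cis (t * u) * z)))
          \<le> \<bar>t\<bar> * norm (deriv f (of_real r * cis (t * u) * z))"
        using r by (intro mult_left_le_one_le) auto
      then show ?case
        using r in_disc[OF z, of u]
        by (auto simp: norm_mult disc_part_eq mult_ac indicator_def intro!: ennreal_leI)
    qed
    finally show "ennreal (norm (f (of_real r * (cis t * z)) - f (of_real r * z)))
        \<le> (\<integral>\<^sup>+u. ennreal (?w u * norm (?H u z)) \<partial>lborel)"
      by (simp add: mult.assoc)
  qed auto
qed

text \<open>
  Go from \<open>z\<close> to \<open>r z\<close>, along the arc to \<open>r e\<^sup>i\<^sup>t z\<close>, and out to \<open>e\<^sup>i\<^sup>t z\<close>. The first and the last step have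
  the same norm by rotation invariance.
\<close>
lemma Lp_le_rotation_diff:
  assumes p: "1 \<le> p" and f: "f holomorphic_on unit_disc" and r: "0 \<le> r" "r \<le> 1"
    and K: "Lp_le p (\<lambda>z. f (of_real r * z) - f z) K"
    and L: "Lp_le p (\<lambda>z. deriv f (of_real r * z)) L"
  shows "Lp_le p (\<lambda>z. f (cis t * z) - f z) (6 * K + 4 * \<bar>t\<bar> * L)"
proof -
  have cont: "continuous_on unit_disc f"
    by (rule holomorphic_on_imp_continuous_on[OF f])
  have contr: "continuous_on unit_disc (\<lambda>z. f (of_real r * z) - f z)"
    using r by (intro continuous_intros continuous_on_dilate cont) simp
  have contt: "continuous_on unit_disc (\<lambda>z. f (of_real r * (cis t * z)) - f (of_real r * z))"
    using r unfolding mult.assoc[symmetric]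
    by (intro continuous_intros continuous_on_dilate cont) (simp_all add: norm_mult)
  have 1: "Lp_le p (\<lambda>z. f (of_real r * (cis t * z)) - f (cis t * z)) K"
    using Lp_le_rotate[OF contr _ K, of "cis t"] by simp
  note 2 = Lp_le_rotation_diff_dilated[OF p f r L, of t]
  have 3: "Lp_le p (\<lambda>z. f (of_real r * (cis t * z)) - f z) (2 * (\<bar>t\<bar> * L + K))"
  proof (rule Lp_le_add[OF p 2 _ K])
    fix z
    show "norm (f (of_real r * (cis t * z)) - f z) \<le> norm (f (of_real r * (cis t * z)) - f (of_real r * z))
        + norm (f (of_real r * z) - f z)"
      using norm_triangle_ineq[of "f (of_real r * (cis t * z)) - f (of_real r * z)" "f (of_real r * z) - f z"]
      by simp
  qed (intro continuous_imp_area_measurable contr contt)+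
  have "Lp_le p (\<lambda>z. f (cis t * z) - f z) (2 * (K + 2 * (\<bar>t\<bar> * L + K)))"
  proof (rule Lp_le_add[OF p 1 _ 3])
    show "(\<lambda>z. f (of_real r * (cis t * z)) - f (cis t * z)) \<in> borel_measurable area_measure"
      "(\<lambda>z. f (of_real r * (cis t * z)) - f z) \<in> borel_measurable area_measure"
      using r unfolding mult.assoc[symmetric]
      by (intro continuous_imp_area_measurable continuous_intros continuous_on_dilate cont; simp add: norm_mult)+
    fix z
    show "norm (f (cis t * z) - f z) \<le> norm (f (of_real r * (cis t * z)) - f (cis t * z))
        + norm (f (of_real r * (cis t * z)) - f z)"
      using norm_triangle_ineq4[of "f (of_real r * (cis t * z)) - f z" "f (of_real r * (cis t * z)) - f (cis t * z)"]
      by simp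
  qed
  then show ?thesis by (simp add: algebra_simps)
qed

text \<open>
  The function \<open>h\<close> of the proof is the mean of \<open>f (z) - f (s z)\<close> over \<open>r \<le> s \<le> 1\<close> for the measure
  \<open>ds / s\<close>, of total mass \<open>L = ln (1 / r)\<close>. Writing it with a primitive \<open>\<Phi>\<close> of \<open>(f (z) - f (0)) / z\<close>
  shows at once that it is holomorphic and that \<open>z h' (z) = z f' (z) - (f (z) - f (r z)) / L\<close>. Both
  \<open>z h'\<close> and the quotient are controlled by \<open>B / (1 - r)\<close>: the first by the Cauchy estimate
  applied to \<open>h\<close>, the second by hypothesis and \<open>L \<ge> 1 - r\<close>.
\<close>
lemma Lp_le_deriv_of_dilation_diff:
  assumes p: "1 \<le> p" and f: "f holomorphic_on unit_disc" and r: "1 / 2 \<le> r" "r < 1" and B: "0 \<le> B"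
    and bnd: "\<And>s. r \<le> s \<Longrightarrow> s < 1 \<Longrightarrow> Lp_le p (\<lambda>z. f (of_real s * z) - f z) B"
  shows "Lp_le p (\<lambda>z. z * deriv f (of_real r * z)) (20 * B / (1 - r))"
proof -
  have cont: "continuous_on unit_disc f"
    by (rule holomorphic_on_imp_continuous_on[OF f])
  define g where "g = (\<lambda>z. if z = 0 then deriv f 0 else (f z - f 0) / (z - 0))"
  have g: "g holomorphic_on unit_disc"
    unfolding g_def by (rule pole_lemma_open[OF f]) simp
  have zg: "z * g z = f z - f 0" for z
    by (simp add: g_def)
  obtain \<Phi> where \<Phi>': "\<And>z. z \<in> unit_disc \<Longrightarrow> (\<Phi> has_field_derivative g z) (at z within unit_disc)"
    using holomorphic_convex_primitive'[OF convex_ball open_ball g] by blast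
  have \<Phi>: "(\<Phi> has_field_derivative g z) (at z)" if "norm z < 1" for z
    using \<Phi>'[of z] that by (simp add: at_within_open[of _ "unit_disc"])
  have hol\<Phi>: "\<Phi> holomorphic_on unit_disc"
    unfolding holomorphic_on_def field_differentiable_def using \<Phi>' by blast
  define L where "L = - ln r"
  have L: "1 - r \<le> L" "0 < L"
    using r ln_le_minus_one[of r] by (auto simp: L_def)
  define h where "h = (\<lambda>z. f z - f 0 - (\<Phi> z - \<Phi> (of_real r * z)) / of_real L)"
  have rD: "norm (of_real r * z) < 1" if "norm z < 1" for z :: complex
    using that r by (intro norm_mult_less_one) auto
  have dh: "(h has_field_derivative deriv f z - (g z - of_real r * g (of_real r * z)) / of_real L) (at z)"
    if "norm z < 1" for z
  proof -
    have "(f has_field_derivative deriv f z) (at z)"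
      by (rule holomorphic_derivI[OF f]) (use that in auto)
    then show ?thesis
      using L unfolding h_def
      by (auto intro!: derivative_eq_intros \<Phi> that DERIV_chain2[where f=\<Phi> and g="\<lambda>z. of_real r * z", OF \<Phi>[OF rD[OF that]]])
  qed
  have h: "h holomorphic_on unit_disc"
    unfolding holomorphic_on_open[OF open_ball] by (intro ballI exI, rule dh) simp
  have zh: "z * deriv h z = z * deriv f z - (f z - f (of_real r * z)) / of_real L" if "norm z < 1" for z
  proof -
    have "z * deriv h z = z * deriv f z - (z * g z - (of_real r * z) * g (of_real r * z)) / of_real L"
      unfolding DERIV_imp_deriv[OF dh[OF that]] by (simp add: algebra_simps diff_divide_distrib)
    then show ?thesis unfolding zg by simp
  qed
  \<comment> \<open>The uniform density on \<open>[r, 1]\<close> dominates \<open>1 / (s L)\<close> up to the factor 2, as \<open>s \<ge> 1/2\<close>.\<close>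
  have "Lp_le p h (2 * B)"
  proof (rule Lp_le_average[OF p])
    let ?w = "\<lambda>s. indicator {r..1} s * (1 / (1 - r)) :: real"
    let ?H = "\<lambda>s z. 2 * (disc_part f (of_real s * z) - disc_part f (1 * z))"
    show "0 \<le> 2 * B" using B by simp
    show "?w \<in> borel_measurable lborel" by measurable
    have mD: "(\<lambda>(s::real, z). disc_part f (of_real s * z)) \<in> borel_measurable (lborel \<Otimes>\<^sub>M area_measure)"
      by (rule measurable_disc_part_mult[OF cont]) measurable
    have mD1: "(\<lambda>(s::real, z). disc_part f (1 * z)) \<in> borel_measurable (lborel \<Otimes>\<^sub>M area_measure)"
      by (rule measurable_disc_part_mult[OF cont]) measurable
    note mD [measurable] mD1 [measurable]
    show "(\<lambda>(s, z). ?H s z) \<in> borel_measurable (lborel \<Otimes>\<^sub>M area_measure)"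
      by measurable
    show "0 \<le> ?w s" for s using r by simp
    have "(\<integral>\<^sup>+s. ennreal (?w s) \<partial>lborel) = ennreal 1"
      using r has_integral_const_real[of "1 / (1 - r)" r 1]
      by (intro nn_integral_indicator_has_integral) auto
    then show "(\<integral>\<^sup>+s. ennreal (?w s) \<partial>lborel) \<le> 1" by simp
    have sD: "norm (of_real s * z) < 1" if "s \<in> {r..1}" "norm z < 1" for s and z :: complex
      using that r by (intro norm_mult_less_one) auto
    show "Lp_le p (?H s) (2 * B)" if "?w s \<noteq> 0" for s
    proof -
      have s: "s \<in> {r..1}" using that by (auto simp: indicator_def split: if_splits)
      have "Lp_le p (\<lambda>z. f (of_real s * z) - f z) B"
      proof (cases "s = 1")
        case True
        then show ?thesis using B by (intro Lp_le_const p) auto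
      qed (use s bnd[of s] in auto)
      moreover have "(\<lambda>z. f (of_real s * z) - f z) \<in> borel_measurable area_measure"
        using s r by (intro continuous_imp_area_measurable continuous_intros continuous_on_dilate cont) auto
      ultimately show ?thesis
        by (rule Lp_le_scale[OF p, where c=2])
             (use sD[OF s] in \<open>auto simp: norm_mult disc_part_eq simp del: right_diff_distrib_numeral\<close>)
    qed
    fix z :: complex assume z: "norm z < 1"
    \<comment> \<open>The derivative of \<open>ln s (f z - f 0) - \<Phi> (s z)\<close> in \<open>s\<close> is \<open>(f z - f (s z)) / s\<close>, and its
      increment over \<open>[r, 1]\<close> is \<open>L h (z)\<close>.\<close>
    have "ennreal (norm ((of_real (ln 1) * (f z - f 0) - \<Phi> (of_real 1 * z)) - (of_real (ln r) * (f z - f 0) - \<Phi> (of_real r * z))))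
      \<le> (\<integral>\<^sup>+s. ennreal (indicator {r..1} s * norm (of_real (1 / s) * (f z - f (of_real s * z)))) \<partial>lborel)"
    proof (rule ennreal_norm_increment_le)
      fix s assume s: "s \<in> {r..1}"
      have s0: "0 < s" using s r by auto
      have "z * deriv \<Phi> (of_real s * z) = of_real (1 / s) * ((of_real s * z) * g (of_real s * z))"
        using s0 by (simp add: DERIV_imp_deriv[OF \<Phi>[OF sD[OF s z]]])
      also have "\<dots> = of_real (1 / s) * (f (of_real s * z) - f 0)"
        unfolding zg ..
      finally have eq: "z * deriv \<Phi> (of_real s * z) = of_real (1 / s) * (f (of_real s * z) - f 0)" .
      have "((\<lambda>s. \<Phi> (of_real s * z)) has_vector_derivative z * deriv \<Phi> (of_real s * z)) (at s within {r..1})"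
        by (rule has_vector_derivative_along[where c="\<lambda>s. of_real s * z", OF hol\<Phi> sD[OF s z]]) (auto intro!: derivative_eq_intros)
      moreover have "((\<lambda>s. complex_of_real (ln s)) has_vector_derivative of_real (1 / s)) (at s within {r..1})"
        using s0 by (intro has_vector_derivative_of_real) (auto intro!: derivative_eq_intros simp: has_real_derivative_iff_has_vector_derivative[symmetric])
      ultimately have "((\<lambda>s. of_real (ln s) * (f z - f 0) - \<Phi> (of_real s * z)) has_vector_derivative
         of_real (1 / s) * (f z - f 0) - of_real (1 / s) * (f (of_real s * z) - f 0)) (at s within {r..1})"
        unfolding eq by (intro has_vector_derivative_diff has_vector_derivative_mult_left)
      then show "((\<lambda>s. of_real (ln s) * (f z - f 0) - \<Phi> (of_real s * z)) has_vector_derivative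
         of_real (1 / s) * (f z - f (of_real s * z))) (at s within {r..1})"
        by (simp add: algebra_simps)
    next
      show "continuous_on {r..1} (\<lambda>s. of_real (1 / s) * (f z - f (of_real s * z)))"
        using sD[OF _ z] r
        by (intro continuous_intros continuous_on_compose2[OF cont]) auto
    qed (use r in auto)
    also have "(of_real (ln 1) * (f z - f 0) - \<Phi> (of_real 1 * z)) - (of_real (ln r) * (f z - f 0) - \<Phi> (of_real r * z))
        = of_real L * h z"
      using L by (simp add: L_def h_def field_simps)
    finally have "ennreal (norm (of_real L * h z)) \<le> (\<integral>\<^sup>+s. ennreal (indicator {r..1} s * norm (of_real (1 / s) * (f z - f (of_real s * z)))) \<partial>lborel)" .
    then have "ennreal (1 / L) * ennreal (norm (of_real L * h z)) \<le> ennreal (1 / L) * (\<integral>\<^sup>+s. ennreal (indicator {r..1} s * norm (of_real (1 / s) * (f z - f (of_real s * z)))) \<partial>lborel)"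
      by (rule mult_left_mono) simp
    also have "\<dots> \<le> ennreal (1 / L) * (\<integral>\<^sup>+s. ennreal L * ennreal (?w s * norm (?H s z)) \<partial>lborel)"
    proof (intro mult_left_mono nn_integral_mono, goal_cases)
      case (1 s)
      show ?case
      proof (cases "s \<in> {r..1}")
        case True
        then have s: "1 / 2 \<le> s" using r by auto
        then have "1 / s \<le> 2" by (simp add: field_simps)
        also have "2 \<le> L * (1 / (1 - r)) * 2" using L r by (simp add: field_simps)
        finally have "1 / s * norm (f z - f (of_real s * z)) \<le> L * (1 / (1 - r)) * 2 * norm (f z - f (of_real s * z))"
          by (rule mult_right_mono) simp
        then show ?thesis
          using True sD[OF True z] z s L r
          by (simp add: disc_part_eq norm_mult norm_divide norm_minus_commute ennreal_mult[symmetric] mult_ac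
              del: right_diff_distrib_numeral)
      qed simp
    qed simp
    also have "\<dots> = ennreal (1 / L) * (ennreal L * (\<integral>\<^sup>+s. ennreal (?w s * norm (?H s z)) \<partial>lborel))"
    proof (subst nn_integral_cmult)
      note borel_measurable_disc_part[OF cont, measurable]
      show "(\<lambda>s. ennreal (?w s * norm (?H s z))) \<in> borel_measurable lborel" by measurable
    qed simp
    also have "\<dots> = (\<integral>\<^sup>+s. ennreal (?w s * norm (?H s z)) \<partial>lborel)"
      using L by (simp add: mult.assoc[symmetric] ennreal_mult[symmetric])
    also have "ennreal (1 / L) * ennreal (norm (of_real L * h z)) = ennreal (norm (h z))"
      using L by (simp add: norm_mult ennreal_mult[symmetric])
    finally show "ennreal (norm (h z)) \<le> (\<integral>\<^sup>+s. ennreal (?w s * norm (?H s z)) \<partial>lborel)" .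
  qed
  then have hw: "Lp_le p (\<lambda>z. h (w * z) - 0 * h z) (2 * B)" if "norm w = 1" for w
    using Lp_le_rotate[OF holomorphic_on_imp_continuous_on[OF h] that] by simp
  have 1: "Lp_le p (\<lambda>z. z * deriv h (of_real r * z)) (8 * B / (1 - r))"
  proof (rule Lp_le_deriv_dilate[OF p _ r(2) h _ hw])
    fix w :: complex assume w: "norm w = 1"
    have "1 - r \<le> norm (w - of_real r)" using norm_circle_minus_ge[OF w] r by simp
    then have "8 * B / norm (w - of_real r) \<le> 8 * B / (1 - r)"
      using r B by (intro divide_left_mono mult_pos_pos) auto
    then show "4 / norm (w - of_real r) * (2 * B) \<le> 8 * B / (1 - r)" by simp
  qed (use r B in auto)
  have "(\<lambda>z. f (of_real r * z) - f z) holomorphic_on unit_disc"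
    using rD by (intro holomorphic_intros f holomorphic_on_compose_gen[OF _ f, unfolded o_def]) auto
  then have 2: "Lp_le p (\<lambda>z. f (of_real r * (of_real r * z)) - f (of_real r * z)) B"
    using r bnd[of r] by (intro Lp_le_dilate[OF p, of r "\<lambda>z. f (of_real r * z) - f z"]) auto
  have contr: "continuous_on unit_disc (\<lambda>z. f (of_real r * (of_real r * z)) - f (of_real r * z))"
    using r unfolding mult.assoc[symmetric]
    by (intro continuous_intros continuous_on_dilate cont) (auto simp: norm_mult intro!: mult_le_one)
  have 3: "Lp_le p (\<lambda>z. (f (of_real r * z) - f (of_real r * (of_real r * z))) / of_real (r * L)) (2 * B / (1 - r))"
  proof (rule Lp_le_scale[OF p 2 continuous_imp_area_measurable[OF contr], of "2 / (1 - r)"])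
    fix z
    have "(1 - r) * 1 \<le> L * (2 * r)" using L r by (intro mult_mono) auto
    then have "1 / (r * L) \<le> 2 / (1 - r)"
      using L r by (simp add: field_simps)
    then have "1 / (r * L) * norm (f (of_real r * z) - f (of_real r * (of_real r * z)))
        \<le> 2 / (1 - r) * norm (f (of_real r * z) - f (of_real r * (of_real r * z)))"
      by (rule mult_right_mono) simp
    then show "norm ((f (of_real r * z) - f (of_real r * (of_real r * z))) / of_real (r * L)) \<le>
        2 / (1 - r) * norm (f (of_real r * (of_real r * z)) - f (of_real r * z))"
      using L r by (simp add: norm_divide norm_mult norm_minus_commute)
  qed (use r in auto)
  have "Lp_le p (\<lambda>z. z * deriv f (of_real r * z)) (2 * (8 * B / (1 - r) + 2 * B / (1 - r)))"
  proof (rule Lp_le_add[OF p 1 _ 3])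
    show "(\<lambda>z. z * deriv h (of_real r * z)) \<in> borel_measurable area_measure"
      using r by (intro continuous_imp_area_measurable continuous_intros continuous_on_dilate continuous_on_deriv_disc h) simp
    show "(\<lambda>z. (f (of_real r * z) - f (of_real r * (of_real r * z))) / of_real (r * L)) \<in> borel_measurable area_measure"
      using L r unfolding mult.assoc[symmetric]
      by (intro continuous_imp_area_measurable continuous_intros continuous_on_dilate cont)
         (auto simp: norm_mult intro!: mult_le_one)
    fix z :: complex assume "norm z < 1"
    note rz = rD[OF this]
    have "z * deriv f (of_real r * z) = z * deriv h (of_real r * z) + (f (of_real r * z) - f (of_real r * (of_real r * z))) / of_real (r * L)"
    proof -
      have "of_real r * (z * deriv f (of_real r * z)) = of_real r * (z * deriv h (of_real r * z) + (f (of_real r * z) - f (of_real r * (of_real r * z))) / of_real (r * L))"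
        using zh[OF rz] r L by (simp add: field_simps)
      then show ?thesis using r by simp
    qed
    then show "norm (z * deriv f (of_real r * z)) \<le> norm (z * deriv h (of_real r * z)) + norm ((f (of_real r * z) - f (of_real r * (of_real r * z))) / of_real (r * L))"
      using norm_triangle_ineq by metis
  qed
  then show ?thesis by simp
qed

section \<open>The equivalence\<close>

text \<open>
  The range of radii is kept above \<open>1/2\<close>, since \<open>Lp_le_deriv_of_dilation_diff\<close> has to bound \<open>1 / s\<close>.
\<close>
lemma bigo_at_left_1_iff:
  fixes N :: "real \<Rightarrow> real"
  assumes N: "\<And>r. 0 \<le> N r"
  shows "N \<in> O[at_left 1](\<lambda>r. (1 - r) powr \<beta>) \<longleftrightarrow>
    (\<exists>C\<ge>0. \<exists>r0. 1 / 2 \<le> r0 \<and> r0 < 1 \<and> (\<forall>r. r0 < r \<longrightarrow> r < 1 \<longrightarrow> N r \<le> C * (1 - r) powr \<beta>))"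
    (is "?L \<longleftrightarrow> ?R")
proof
  assume ?L
  then obtain C where C: "C > 0" "\<forall>\<^sub>F r in at_left 1. norm (N r) \<le> C * norm ((1 - r) powr \<beta>)"
    by (rule landau_o.bigE)
  from C(2) obtain b where b: "b < 1" "\<And>r. b < r \<Longrightarrow> r < 1 \<Longrightarrow> norm (N r) \<le> C * norm ((1 - r) powr \<beta>)"
    unfolding eventually_at_left_field by blast
  have "N r \<le> C * (1 - r) powr \<beta>" if "max b (1 / 2) < r" "r < 1" for r
    using b(2)[of r] that N[of r] by simp
  then show ?R
    using C(1) b(1) by (intro exI[of _ C] conjI exI[of _ "max b (1 / 2)"] allI impI) auto
next
  assume ?R
  then obtain C r0 where *: "0 \<le> C" "r0 < 1" "\<And>r. r0 < r \<Longrightarrow> r < 1 \<Longrightarrow> N r \<le> C * (1 - r) powr \<beta>"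
    by blast
  have "norm (N r) \<le> C * norm ((1 - r) powr \<beta>)" if "r0 < r" "r < 1" for r
    using *(3)[OF that] N[of r] by simp
  then have "\<forall>\<^sub>F r in at_left 1. norm (N r) \<le> C * norm ((1 - r) powr \<beta>)"
    unfolding eventually_at_left_field using *(2) by blast
  then show ?L by (rule bigoI)
qed

lemma bigo_at_0_iff:
  fixes N :: "real \<Rightarrow> real"
  assumes N: "\<And>t. 0 \<le> N t"
  shows "N \<in> O[at 0](\<lambda>t. \<bar>t\<bar> powr \<beta>) \<longleftrightarrow>
    (\<exists>C\<ge>0. \<exists>d>0. \<forall>t. t \<noteq> 0 \<longrightarrow> \<bar>t\<bar> < d \<longrightarrow> N t \<le> C * \<bar>t\<bar> powr \<beta>)"
    (is "?L \<longleftrightarrow> ?R")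
proof
  assume ?L
  then obtain C where C: "C > 0" "\<forall>\<^sub>F t in at 0. norm (N t) \<le> C * norm (\<bar>t\<bar> powr \<beta>)"
    by (rule landau_o.bigE)
  then show ?R
    using N by (intro exI[of _ C]) (auto simp: eventually_at)
next
  assume ?R
  then obtain C where C: "\<exists>d>0. \<forall>t. t \<noteq> 0 \<longrightarrow> \<bar>t\<bar> < d \<longrightarrow> N t \<le> C * \<bar>t\<bar> powr \<beta>"
    by blast
  then have "\<forall>\<^sub>F t in at 0. norm (N t) \<le> C * norm (\<bar>t\<bar> powr \<beta>)"
    using N by (auto simp: eventually_at)
  then show ?L by (rule bigoI)
qed

lemma bergman_norm_nonneg: "0 \<le> bergman_norm p f"
  by (simp add: bergman_norm_def)

lemma area_mean_nonneg: "0 \<le> area_mean p r f"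
  by (simp add: area_mean_def bergman_norm_nonneg)

lemma bergman_space_Lp_le:
  assumes p: "1 \<le> p" and "f \<in> bergman_space p"
  obtains K where "Lp_le p f K"
proof -
  have int: "integrable area_measure (\<lambda>z. norm (f z) powr p)"
    using assms(2) by (simp add: bergman_space_def)
  have I0: "0 \<le> (\<integral>z. norm (f z) powr p \<partial>area_measure)"
    by (rule integral_nonneg_AE) simp
  have "(\<integral>\<^sup>+z. ennreal (norm (f z) powr p) \<partial>area_measure)
      = ennreal (\<integral>z. norm (f z) powr p \<partial>area_measure)"
    by (rule nn_integral_eq_integral[OF int]) simp
  then have "Lp_le p f ((\<integral>z. norm (f z) powr p \<partial>area_measure) powr (1 / p))"
    using p I0 by (simp add: Lp_le_def powr_powr)
  then show ?thesis by (rule that)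
qed

lemma dilate_diff_area_measurable:
  assumes "f holomorphic_on unit_disc" "norm c \<le> 1"
  shows "(\<lambda>z. f (c * z) - f z) \<in> borel_measurable area_measure"
proof -
  have "continuous_on unit_disc f"
    by (rule holomorphic_on_imp_continuous_on[OF assms(1)])
  from continuous_on_diff[OF continuous_on_dilate[OF this assms(2)] this] show ?thesis
    by (rule continuous_imp_area_measurable)
qed

lemma Lp_le_dilate_diff_finite:
  assumes p: "1 \<le> p" and f: "f holomorphic_on unit_disc" and c: "norm c \<le> 1"
    and 1: "Lp_le p (\<lambda>z. f (c * z)) K" and 2: "Lp_le p f K"
  shows "Lp_le p (\<lambda>z. f (c * z) - f z) (4 * K)"
proof -
  note cont = holomorphic_on_imp_continuous_on[OF f]
  have "Lp_le p (\<lambda>z. f (c * z) - f z) (2 * (K + K))"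
    by (rule Lp_le_add[OF p 1 continuous_imp_area_measurable[OF continuous_on_dilate[OF cont c]]
          2 continuous_imp_area_measurable[OF cont] norm_triangle_ineq4])
  then show ?thesis by simp
qed

lemma deriv_dilate_area_measurable:
  assumes "f holomorphic_on unit_disc" "norm c \<le> 1"
  shows "(\<lambda>z. deriv f (c * z)) \<in> borel_measurable area_measure"
  using continuous_on_dilate[OF continuous_on_deriv_disc[OF assms(1)] assms(2)]
  by (rule continuous_imp_area_measurable)

lemma deriv_bounded_on_cball:
  assumes "f holomorphic_on unit_disc" "r < 1"
  obtains M where "\<And>z. norm z \<le> r \<Longrightarrow> norm (deriv f z) \<le> M"
proof -
  have "compact (deriv f ` cball 0 r)"
    using assms(2)
    by (intro compact_continuous_image continuous_on_subset[OF continuous_on_deriv_disc[OF assms(1)]]) auto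
  then obtain M where "\<forall>w\<in>deriv f ` cball 0 r. norm w \<le> M"
    using compact_imp_bounded bounded_iff by blast
  then show ?thesis by (intro that[of M]) simp
qed

lemma Lp_le_deriv_dilate_finite:
  assumes p: "1 \<le> p" and f: "f holomorphic_on unit_disc" and r: "0 \<le> r" "r < 1"
  obtains M where "Lp_le p (\<lambda>z. deriv f (of_real r * z)) M"
proof -
  obtain M where M: "\<And>z. norm z \<le> r \<Longrightarrow> norm (deriv f z) \<le> M"
    using deriv_bounded_on_cball[OF f r(2)] by blast
  have M0: "0 \<le> M" using order_trans[OF norm_ge_zero M[of 0]] r by simp
  show ?thesis
  proof (rule that[of M], rule Lp_le_const[OF p M0], rule M)
    fix z :: complex assume "norm z < 1"
    then show "norm (of_real r * z) \<le> r"
      using r mult_left_mono[of "norm z" 1 r] by (simp add: norm_mult)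
  qed
qed

lemma area_mean_le_imp_Lp_le:
  assumes p: "1 \<le> p" and f: "f holomorphic_on unit_disc" and r: "0 \<le> r" "r < 1"
    and "area_mean p r (deriv f) \<le> K"
  shows "Lp_le p (\<lambda>z. deriv f (of_real r * z)) K"
proof -
  obtain M where "Lp_le p (\<lambda>z. deriv f (of_real r * z)) M"
    using Lp_le_deriv_dilate_finite[OF p f r] .
  moreover have "(\<lambda>z. deriv f (of_real r * z)) \<in> borel_measurable area_measure"
    using r by (intro deriv_dilate_area_measurable f) simp
  ultimately show ?thesis
    using Lp_le_of_bergman_norm_le[OF p] assms(5) by (simp add: area_mean_def dilation_def)
qed

lemma Lp_le_imp_area_mean_le:
  assumes p: "1 \<le> p" and f: "f holomorphic_on unit_disc" and r: "0 \<le> r" "r < 1"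
    and "Lp_le p (\<lambda>z. deriv f (of_real r * z)) K"
  shows "area_mean p r (deriv f) \<le> K"
proof -
  have "(\<lambda>z. deriv f (of_real r * z)) \<in> borel_measurable area_measure"
    using r by (intro deriv_dilate_area_measurable f) simp
  with bergman_norm_le[OF p assms(5)] show ?thesis
    by (simp add: area_mean_def dilation_def)
qed

text \<open>
  The bounded term that remains from \<open>\<bar>z\<bar> \<le> 1/2\<close> is absorbed because \<open>(1 - r) powr (\<alpha> - 1) \<ge> 1\<close>.
\<close>
lemma area_mean_deriv_bigo:
  assumes p: "1 \<le> p" and \<alpha>: "\<alpha> \<le> 1" and f: "f holomorphic_on unit_disc"
    and C: "0 \<le> C" and r0: "1 / 2 \<le> r0" "r0 < 1"
    and bnd: "\<And>r. r0 < r \<Longrightarrow> r < 1 \<Longrightarrow>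
      Lp_le p (\<lambda>z. z * deriv f (of_real r * z)) (C * (1 - r) powr (\<alpha> - 1))"
  shows "(\<lambda>r. area_mean p r (deriv f)) \<in> O[at_left 1](\<lambda>r. (1 - r) powr (\<alpha> - 1))"
proof -
  obtain M where M: "\<And>z. norm z \<le> 1 / 2 \<Longrightarrow> norm (deriv f z) \<le> M"
    using deriv_bounded_on_cball[OF f, of "1 / 2"] by auto
  have M0: "0 \<le> M" using order_trans[OF norm_ge_zero M[of 0]] by simp
  have "area_mean p r (deriv f) \<le> (4 * C + 2 * M) * (1 - r) powr (\<alpha> - 1)" if r: "r0 < r" "r < 1" for r
  proof -
    have r': "0 \<le> r" "r \<le> 1" using r r0 by auto
    have "area_mean p r (deriv f) \<le> 2 * (2 * (C * (1 - r) powr (\<alpha> - 1)) + M)"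
      by (rule Lp_le_imp_area_mean_le[OF p f r'(1) r(2)
          Lp_le_cancel_id[OF p r' continuous_on_deriv_disc[OF f] bnd[OF r] M]])
    also have "\<dots> \<le> (4 * C + 2 * M) * (1 - r) powr (\<alpha> - 1)"
    proof -
      have "(1 - r) powr 0 \<le> (1 - r) powr (\<alpha> - 1)"
        using \<alpha> r r0 by (intro powr_mono') auto
      then have "M * 1 \<le> M * (1 - r) powr (\<alpha> - 1)"
        using M0 r by (intro mult_left_mono) auto
      then show ?thesis by (simp add: algebra_simps)
    qed
    finally show ?thesis .
  qed
  moreover have "0 \<le> 4 * C + 2 * M" using C M0 by simp
  ultimately show ?thesis
    using r0 by (subst bigo_at_left_1_iff[OF area_mean_nonneg]) blast
qed

text \<open>
  The average in \<open>Lp_le_deriv_dilate\<close> runs over the whole circle, whereas the hypothesis concerns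
  rotations by small angles. Away from \<open>w = 1\<close> the power \<open>\<bar>w - 1\<bar>\<^sup>\<alpha>\<close> is bounded below and the norm of \<open>f\<close>
  takes care of the difference.
\<close>
lemma rotation_bigo_imp_deriv_bigo:
  assumes p: "1 \<le> p" and \<alpha>: "0 < \<alpha>" "\<alpha> \<le> 1" and fb: "f \<in> bergman_space p"
    and a: "(\<lambda>t. bergman_norm p (\<lambda>z. rotation t f z - f z)) \<in> O[at 0](\<lambda>t. \<bar>t\<bar> powr \<alpha>)"
  shows "(\<lambda>r. area_mean p r (deriv f)) \<in> O[at_left 1](\<lambda>r. (1 - r) powr (\<alpha> - 1))"
proof -
  have f: "f holomorphic_on unit_disc" using fb by (simp add: bergman_space_def)
  have cont: "continuous_on unit_disc f" by (rule holomorphic_on_imp_continuous_on[OF f])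
  obtain K where K: "Lp_le p f K" using bergman_space_Lp_le[OF p fb] .
  have K0: "0 \<le> K" by (rule Lp_le_nonneg[OF K])
  have meas: "(\<lambda>z. f (w * z) - f z) \<in> borel_measurable area_measure" if "norm w = 1" for w
    using that by (intro dilate_diff_area_measurable[OF f]) simp
  have fin: "Lp_le p (\<lambda>z. f (w * z) - f z) (4 * K)" if w: "norm w = 1" for w
    using w by (intro Lp_le_dilate_diff_finite[OF p f _ Lp_le_rotate[OF cont w K] K]) simp
  obtain C d where C: "0 \<le> C" and d: "0 < d"
    and Cd: "\<And>t. t \<noteq> 0 \<Longrightarrow> \<bar>t\<bar> < d \<Longrightarrow> bergman_norm p (\<lambda>z. rotation t f z - f z) \<le> C * \<bar>t\<bar> powr \<alpha>"
    using a unfolding bigo_at_0_iff[OF bergman_norm_nonneg] by blast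
  define e where "e = min (1 / 2) (d / 2)"
  have e: "0 < e" using d by (simp add: e_def)
  define D where "D = 2 * C + 4 * K / e powr \<alpha>"
  have D0: "0 \<le> D" using C K0 by (simp add: D_def)
  have D: "Lp_le p (\<lambda>z. f (w * z) - f z) (D * norm (w - 1) powr \<alpha>)" if w: "norm w = 1" for w
  proof (cases "norm (w - 1) < e")
    case True
    show ?thesis
    proof (cases "w = 1")
      case True
      then show ?thesis using p by (intro Lp_le_const) auto
    next
      case False
      \<comment> \<open>the angle of \<open>w\<close>, small because \<open>Ln\<close> is Lipschitz near 1\<close>
      define t where "t = Im (Ln w)"
      have w0: "w \<noteq> 0" using w by auto
      have "w = exp (Ln w)" using w0 by simp
      also have "\<dots> = cis t"
        using w w0 by (simp add: exp_eq_polar t_def)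
      finally have wt: "w = cis t" .
      have "\<bar>t\<bar> \<le> norm (Ln (1 + (w - 1)))"
        unfolding t_def by (simp add: abs_Im_le_cmod)
      also have "\<dots> \<le> 2 * norm (w - 1)"
        using True by (intro norm_Ln_le) (simp add: e_def)
      finally have t: "\<bar>t\<bar> \<le> 2 * norm (w - 1)" .
      then have "\<bar>t\<bar> < d" using True by (simp add: e_def)
      moreover have "t \<noteq> 0" using wt False by auto
      ultimately have "bergman_norm p (\<lambda>z. f (w * z) - f z) \<le> C * \<bar>t\<bar> powr \<alpha>"
        using Cd[of t] by (simp add: rotation_def wt)
      also have "\<dots> \<le> C * (2 * norm (w - 1)) powr \<alpha>"
        using t C \<alpha> by (intro mult_left_mono powr_mono2) auto
      also have "\<dots> = C * (2 powr \<alpha> * norm (w - 1) powr \<alpha>)"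
        by (simp add: powr_mult)
      also have "\<dots> \<le> C * (2 powr 1 * norm (w - 1) powr \<alpha>)"
        using C \<alpha> by (intro mult_left_mono mult_right_mono powr_mono) auto
      also have "\<dots> = (2 * C) * norm (w - 1) powr \<alpha>" by simp
      also have "\<dots> \<le> D * norm (w - 1) powr \<alpha>"
        using K0 by (intro mult_right_mono) (auto simp: D_def)
      finally show ?thesis
        by (rule Lp_le_of_bergman_norm_le[OF p _ fin[OF w] meas[OF w]])
    qed
  next
    case False
    have "e powr \<alpha> \<le> norm (w - 1) powr \<alpha>"
      using False e \<alpha> by (intro powr_mono2) auto
    then have "4 * K / e powr \<alpha> * e powr \<alpha> \<le> D * norm (w - 1) powr \<alpha>"
      using K0 C by (intro mult_mono) (auto simp: D_def)
    then have "1 * (4 * K) \<le> D * norm (w - 1) powr \<alpha>"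
      using e by simp
    then show ?thesis
      by (intro Lp_le_scale[OF p fin[OF w] meas[OF w], of 1]) auto
  qed
  have "Lp_le p (\<lambda>z. z * deriv f (of_real r * z)) (8 * D * (1 - r) powr (\<alpha> - 1))" if r: "1 / 2 < r" "r < 1" for r
  proof (rule Lp_le_deriv_dilate[OF p _ r(2) f, where c=1 and B="\<lambda>w. D * norm (w - 1) powr \<alpha>"])
    show "0 \<le> 8 * D * (1 - r) powr (\<alpha> - 1)" using D0 by simp
    fix w :: complex assume w: "norm w = 1"
    show "Lp_le p (\<lambda>z. f (w * z) - 1 * f z) (D * norm (w - 1) powr \<alpha>)"
      using D[OF w] by simp
    let ?d = "norm (w - of_real r)"
    have d: "1 - r \<le> ?d" "0 < ?d"
      using norm_circle_minus_ge[OF w, of r] r by auto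
    have "norm (w - 1) powr \<alpha> \<le> (2 * ?d) powr \<alpha>"
      using norm_minus_one_le[OF w, of r] r \<alpha> by (intro powr_mono2) auto
    also have "\<dots> = 2 powr \<alpha> * ?d powr \<alpha>" by (simp add: powr_mult)
    also have "\<dots> \<le> 2 powr 1 * ?d powr \<alpha>"
      using \<alpha> by (intro mult_right_mono powr_mono) auto
    finally have "4 / ?d * (D * norm (w - 1) powr \<alpha>) \<le> 4 / ?d * (D * (2 * ?d powr \<alpha>))"
      using D0 by (intro mult_left_mono) auto
    also have "\<dots> = 8 * D * ?d powr (\<alpha> - 1)"
      using d by (simp add: powr_diff)
    also have "\<dots> \<le> 8 * D * (1 - r) powr (\<alpha> - 1)"
      using d D0 r \<alpha> by (intro mult_left_mono powr_mono2') auto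
    finally show "4 / ?d * (D * norm (w - 1) powr \<alpha>) \<le> 8 * D * (1 - r) powr (\<alpha> - 1)" .
  qed (use r in auto)
  then show ?thesis
    using D0 by (intro area_mean_deriv_bigo[OF p \<alpha>(2) f, of "8 * D" "1 / 2"]) auto
qed

lemma deriv_bigo_imp_dilation_diff:
  assumes p: "1 \<le> p" and \<alpha>: "0 < \<alpha>" and f: "f holomorphic_on unit_disc"
    and b: "(\<lambda>r. area_mean p r (deriv f)) \<in> O[at_left 1](\<lambda>r. (1 - r) powr (\<alpha> - 1))"
  obtains C r0 where "0 \<le> C" "1 / 2 \<le> r0" "r0 < 1"
    "\<And>r. r0 < r \<Longrightarrow> r < 1 \<Longrightarrow> Lp_le p (\<lambda>z. deriv f (of_real r * z)) (C * (1 - r) powr (\<alpha> - 1))"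
    "\<And>r. r0 < r \<Longrightarrow> r < 1 \<Longrightarrow> Lp_le p (\<lambda>z. f (of_real r * z) - f z) (C / \<alpha> * (1 - r) powr \<alpha>)"
proof -
  obtain C r0 where C: "0 \<le> C" and r0: "1 / 2 \<le> r0" "r0 < 1"
    and Cr: "\<And>r. r0 < r \<Longrightarrow> r < 1 \<Longrightarrow> area_mean p r (deriv f) \<le> C * (1 - r) powr (\<alpha> - 1)"
    using b unfolding bigo_at_left_1_iff[OF area_mean_nonneg] by blast
  have 1: "Lp_le p (\<lambda>z. deriv f (of_real r * z)) (C * (1 - r) powr (\<alpha> - 1))" if "r0 < r" "r < 1" for r
    using that r0 Cr by (intro area_mean_le_imp_Lp_le[OF p f]) auto
  have 2: "Lp_le p (\<lambda>z. f (of_real r * z) - f z) (C / \<alpha> * (1 - r) powr \<alpha>)" if "r0 < r" "r < 1" for r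
    using that r0 C by (intro Lp_le_dilation_diff[OF p \<alpha> f] 1) auto
  show ?thesis by (rule that[OF C r0 1 2])
qed

lemma deriv_bigo_imp_rotation_bigo:
  assumes p: "1 \<le> p" and \<alpha>: "0 < \<alpha>" and f: "f holomorphic_on unit_disc"
    and b: "(\<lambda>r. area_mean p r (deriv f)) \<in> O[at_left 1](\<lambda>r. (1 - r) powr (\<alpha> - 1))"
  shows "(\<lambda>t. bergman_norm p (\<lambda>z. rotation t f z - f z)) \<in> O[at 0](\<lambda>t. \<bar>t\<bar> powr \<alpha>)"
proof -
  have cont: "continuous_on unit_disc f" by (rule holomorphic_on_imp_continuous_on[OF f])
  obtain C r0 where C: "0 \<le> C" and r0: "1 / 2 \<le> r0" "r0 < 1"
    and 1: "\<And>r. r0 < r \<Longrightarrow> r < 1 \<Longrightarrow> Lp_le p (\<lambda>z. deriv f (of_real r * z)) (C * (1 - r) powr (\<alpha> - 1))"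
    and 2: "\<And>r. r0 < r \<Longrightarrow> r < 1 \<Longrightarrow> Lp_le p (\<lambda>z. f (of_real r * z) - f z) (C / \<alpha> * (1 - r) powr \<alpha>)"
    by (rule deriv_bigo_imp_dilation_diff[OF p \<alpha> f b]) blast
  have "bergman_norm p (\<lambda>z. rotation t f z - f z) \<le> (6 * C / \<alpha> + 4 * C) * \<bar>t\<bar> powr \<alpha>"
    if t: "t \<noteq> 0" "\<bar>t\<bar> < 1 - r0" for t
  proof -
    let ?r = "1 - \<bar>t\<bar>"
    have r: "r0 < ?r" "?r < 1" "0 \<le> ?r" "?r \<le> 1" using t r0 by auto
    have "Lp_le p (\<lambda>z. f (cis t * z) - f z)
        (6 * (C / \<alpha> * (1 - ?r) powr \<alpha>) + 4 * \<bar>t\<bar> * (C * (1 - ?r) powr (\<alpha> - 1)))"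
      by (rule Lp_le_rotation_diff[OF p f r(3,4) 2[OF r(1,2)] 1[OF r(1,2)]])
    then have "bergman_norm p (\<lambda>z. f (cis t * z) - f z)
        \<le> 6 * (C / \<alpha> * (1 - ?r) powr \<alpha>) + 4 * \<bar>t\<bar> * (C * (1 - ?r) powr (\<alpha> - 1))"
      by (rule bergman_norm_le[OF p])
         (rule dilate_diff_area_measurable[OF f], simp)
    also have "\<dots> = (6 * C / \<alpha> + 4 * C) * \<bar>t\<bar> powr \<alpha>"
      using t by (simp add: powr_diff algebra_simps)
    finally show ?thesis by (simp add: rotation_def)
  qed
  moreover have "0 \<le> 6 * C / \<alpha> + 4 * C" using C \<alpha> by simp
  moreover have "0 < 1 - r0" using r0 by simp
  ultimately show ?thesis
    by (subst bigo_at_0_iff[OF bergman_norm_nonneg]) blast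
qed

lemma deriv_bigo_imp_dilation_bigo:
  assumes p: "1 \<le> p" and \<alpha>: "0 < \<alpha>" and f: "f holomorphic_on unit_disc"
    and b: "(\<lambda>r. area_mean p r (deriv f)) \<in> O[at_left 1](\<lambda>r. (1 - r) powr (\<alpha> - 1))"
  shows "(\<lambda>r. bergman_norm p (\<lambda>z. dilation r f z - f z)) \<in> O[at_left 1](\<lambda>r. (1 - r) powr \<alpha>)"
proof -
  have cont: "continuous_on unit_disc f" by (rule holomorphic_on_imp_continuous_on[OF f])
  obtain C r0 where C: "0 \<le> C" and r0: "1 / 2 \<le> r0" "r0 < 1"
    and 1: "\<And>r. r0 < r \<Longrightarrow> r < 1 \<Longrightarrow> Lp_le p (\<lambda>z. deriv f (of_real r * z)) (C * (1 - r) powr (\<alpha> - 1))"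
    and 2: "\<And>r. r0 < r \<Longrightarrow> r < 1 \<Longrightarrow> Lp_le p (\<lambda>z. f (of_real r * z) - f z) (C / \<alpha> * (1 - r) powr \<alpha>)"
    by (rule deriv_bigo_imp_dilation_diff[OF p \<alpha> f b]) blast
  have "bergman_norm p (\<lambda>z. dilation r f z - f z) \<le> C / \<alpha> * (1 - r) powr \<alpha>" if "r0 < r" "r < 1" for r
    using that r0 unfolding dilation_def
    by (intro bergman_norm_le[OF p 2] dilate_diff_area_measurable[OF f]) auto
  moreover have "0 \<le> C / \<alpha>" using C \<alpha> by simp
  ultimately show ?thesis
    using r0 by (subst bigo_at_left_1_iff[OF bergman_norm_nonneg]) blast
qed

lemma dilation_bigo_imp_deriv_bigo:
  assumes p: "1 \<le> p" and \<alpha>: "0 < \<alpha>" "\<alpha> \<le> 1" and fb: "f \<in> bergman_space p"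
    and c: "(\<lambda>r. bergman_norm p (\<lambda>z. dilation r f z - f z)) \<in> O[at_left 1](\<lambda>r. (1 - r) powr \<alpha>)"
  shows "(\<lambda>r. area_mean p r (deriv f)) \<in> O[at_left 1](\<lambda>r. (1 - r) powr (\<alpha> - 1))"
proof -
  have f: "f holomorphic_on unit_disc" using fb by (simp add: bergman_space_def)
  have cont: "continuous_on unit_disc f" by (rule holomorphic_on_imp_continuous_on[OF f])
  obtain K where K: "Lp_le p f K" using bergman_space_Lp_le[OF p fb] .
  obtain C r0 where C: "0 \<le> C" and r0: "1 / 2 \<le> r0" "r0 < 1"
    and Cr: "\<And>r. r0 < r \<Longrightarrow> r < 1 \<Longrightarrow> bergman_norm p (\<lambda>z. dilation r f z - f z) \<le> C * (1 - r) powr \<alpha>"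
    using c unfolding bigo_at_left_1_iff[OF bergman_norm_nonneg] by blast
  have D: "Lp_le p (\<lambda>z. f (of_real r * z) - f z) (C * (1 - r) powr \<alpha>)" if r: "r0 < r" "r < 1" for r
  proof (rule Lp_le_of_bergman_norm_le[OF p])
    show "bergman_norm p (\<lambda>z. f (of_real r * z) - f z) \<le> C * (1 - r) powr \<alpha>"
      using Cr[OF r] by (simp add: dilation_def)
    have "Lp_le p (\<lambda>z. f (of_real r * z)) K"
      using r r0 by (intro Lp_le_dilate[OF p _ _ f K]) auto
    then show "Lp_le p (\<lambda>z. f (of_real r * z) - f z) (4 * K)"
      using r r0 by (intro Lp_le_dilate_diff_finite[OF p f _ _ K]) auto
    show "(\<lambda>z. f (of_real r * z) - f z) \<in> borel_measurable area_measure"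
      using r r0 by (intro dilate_diff_area_measurable[OF f]) simp
  qed
  have "Lp_le p (\<lambda>z. z * deriv f (of_real r * z)) (20 * C * (1 - r) powr (\<alpha> - 1))"
    if r: "r0 < r" "r < 1" for r
  proof -
    have B: "0 \<le> C * (1 - r) powr \<alpha>" using C by simp
    have "Lp_le p (\<lambda>z. z * deriv f (of_real r * z)) (20 * (C * (1 - r) powr \<alpha>) / (1 - r))"
    proof (rule Lp_le_deriv_of_dilation_diff[OF p f _ r(2) B])
      fix s assume s: "r \<le> s" "s < 1"
      have le: "1 * (C * (1 - s) powr \<alpha>) \<le> C * (1 - r) powr \<alpha>"
        using s C \<alpha> by (simp add: mult_left_mono powr_mono2)
      have "Lp_le p (\<lambda>z. f (of_real s * z) - f z) (C * (1 - s) powr \<alpha>)"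
        using s r by (intro D) auto
      moreover have "(\<lambda>z. f (of_real s * z) - f z) \<in> borel_measurable area_measure"
        using s r r0 by (intro dilate_diff_area_measurable[OF f]) simp
      ultimately show "Lp_le p (\<lambda>z. f (of_real s * z) - f z) (C * (1 - r) powr \<alpha>)"
        by (rule Lp_le_scale[OF p, of "\<lambda>z. f (of_real s * z) - f z" "C * (1 - s) powr \<alpha>" 1])
           (use le in auto)
    qed (use r r0 in auto)
    also have "20 * (C * (1 - r) powr \<alpha>) / (1 - r) = 20 * C * (1 - r) powr (\<alpha> - 1)"
      using r by (simp add: powr_diff)
    finally show ?thesis .
  qed
  then show ?thesis
    using C by (intro area_mean_deriv_bigo[OF p \<alpha>(2) f _ r0, of "20 * C"]) simp_all
qed

theorem theorem4p1:
  fixes p \<alpha> :: real and f :: "complex \<Rightarrow> complex"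
  assumes "1 \<le> p" and "0 < \<alpha>" and "\<alpha> \<le> 1" and "f \<in> bergman_space p"
  shows "(((\<lambda>t. bergman_norm p (\<lambda>z. rotation t f z - f z)) \<in> O[at 0](\<lambda>t. \<bar>t\<bar> powr \<alpha>))
       \<longleftrightarrow> ((\<lambda>r. area_mean p r (deriv f)) \<in> O[at_left 1](\<lambda>r. (1 - r) powr (\<alpha> - 1)))) \<and>
      (((\<lambda>r. area_mean p r (deriv f)) \<in> O[at_left 1](\<lambda>r. (1 - r) powr (\<alpha> - 1)))
       \<longleftrightarrow> ((\<lambda>r. bergman_norm p (\<lambda>z. dilation r f z - f z)) \<in> O[at_left 1](\<lambda>r. (1 - r) powr \<alpha>)))"
proof -
  have f: "f holomorphic_on unit_disc"
    using assms(4) by (simp add: bergman_space_def)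
  show ?thesis
    using rotation_bigo_imp_deriv_bigo[OF assms] deriv_bigo_imp_rotation_bigo[OF assms(1,2) f]
      deriv_bigo_imp_dilation_bigo[OF assms(1,2) f] dilation_bigo_imp_deriv_bigo[OF assms]
    by blast
qed

end
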